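(* Let $1<p<\infty$, $1/q=1-1/p$, let $k\in\mathbf{R}$ with $k\neq\tan(\tfrac{\pi}{2q})$, and let $\alpha$ be the number in $(1/q-2,1/q)$, $\alpha\ne-1$, such that $\tan(\pi\alpha/2)=k$. Let $u\in L_p(\mathbf{R};\mathbf{C})$. Then the solution $U$ of the Dirichlet problem (Dir-$A_k,p$) with boundary datum $u$ obtained by the boundary equation method is given, for $(t,x)\in\mathbf{R}^2_+$, by $$U(t,x)=\frac1\pi\int_{\mathbf{R}}\frac{2xty+|y|^{-\alpha}\,\mathrm{Im}\big\{(|x|+it)^{\alpha+1}\big(y^2-(|x|-it)^2\big)\big\}}{(t^2+(x-y)^2)(t^2+(x+y)^2)}\,u(y)\,dy .$$
   Context: $\mathbf{R}^2_+=\{(t,x): t>0, x\in\mathbf{R}\}$. Powers $(|x|+it)^{\alpha+1}$ are defined with $\arg(|x|+it)\in(0,\pi)$. The Dirichlet problem (Dir-$A_k,p$) is $\mathrm{div}A_k(x)\nabla U=0$ in $\mathbf{R}^2_+$, $U(0,\cdot)=u$, with $A_k(x)=\begin{bmatrix}1&k\,\mathrm{sgn}(x)\\-k\,\mathrm{sgn}(x)&1\end{bmatrix}$ (indices ordered $(t,x)$). Let $Kf(x):=\mathrm{sgn}(x)\frac1\pi\,\mathrm{p.v.}\!\int_{\mathbf{R}}\frac{f(y)}{x-y}dy-\frac1\pi\int_{\mathbf{R}}\frac{f(y)}{|x|+|y|}dy$, and let $(I+kK)^*$ acting on $L_p(\mathbf{R};\mathbf{C})$ be the adjoint of $I+kK$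 acting on $L_q(\mathbf{R};\mathbf{C})$, i.e. $K^*f(x)=-\frac1\pi\,\mathrm{p.v.}\!\int\frac{\mathrm{sgn}(y)f(y)}{x-y}dy-\frac1\pi\int\frac{f(y)}{|x|+|y|}dy$. When $k\ne\tan(\pi/(2q))$, the operator $(I+kK)^*$ is an isomorphism of $L_p(\mathbf{R};\mathbf{C})$. The solution obtained by the boundary equation method is $$U(t,x)=\frac1{2\pi}\int_{\mathbf{R}}\left(\frac{t-(x-y)k\,\mathrm{sgn}(y)}{t^2+(x-y)^2}-k\frac{|x|+|y|}{t^2+(|x|+|y|)^2}\right)\psi(y)\,dy,$$ where $\psi\in L_p(\mathbf{R};\mathbf{C})$ is the unique solution of $u=\tfrac12(I+kK)^*\psi$. *)

theory Defs
  imports "HOL-Analysis.Analysis"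
begin

text \<open>
  Elements of $L_p(\mathbf{R};\mathbf{C})$ are represented by functions; equality in $L_p$ is
  equality almost everywhere.
\<close>

definition Lp :: "real \<Rightarrow> (real \<Rightarrow> complex) set" where
  "Lp p = {f \<in> borel_measurable lborel. integrable lborel (\<lambda>x. norm (f x) powr p)}"

text \<open>
  For \<open>f\<close> in \<open>Lp q\<close> with $1<q<\infty$ the limit below exists for almost every \<open>x\<close>;
  on the remaining null set the value is irrelevant.
\<close>

definition pv_integral :: "(real \<Rightarrow> complex) \<Rightarrow> real \<Rightarrow> complex" where
  "pv_integral f x =
     Lim (at_right 0) (\<lambda>\<epsilon>. LINT y:{y. \<bar>x - y\<bar> > \<epsilon>}|lborel. f y / of_real (x - y))"

definition K_op :: "(real \<Rightarrow> complex) \<Rightarrow> real \<Rightarrow> complex" where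
  "K_op f x =
     of_real (sgn x) * (1 / of_real pi) * pv_integral f x
     - (1 / of_real pi) * (LINT y|lborel. f y / of_real (\<bar>x\<bar> + \<bar>y\<bar>))"

definition I_plus_kK :: "real \<Rightarrow> (real \<Rightarrow> complex) \<Rightarrow> real \<Rightarrow> complex" where
  "I_plus_kK k f x = f x + of_real k * K_op f x"

text \<open>
  \<open>is_adjoint_value p q T \<psi> v\<close> says that $T^*\psi = v$, where \<open>T\<close> acts on $L_q$ and its adjoint
  $T^*$ acts on $L_p$, in the duality $\langle f,g\rangle = \int f g$. For operators commuting
  with complex conjugation, such as \<open>I_plus_kK k\<close>, the sesquilinear duality
  $\int f \overline{g}$ gives the same adjoint. The value \<open>v\<close> is determined almost everywhere.
\<close>

definition is_adjoint_value ::
    "real \<Rightarrow> real \<Rightarrow> ((real \<Rightarrow> complex) \<Rightarrow> real \<Rightarrow> complex) \<Rightarrow>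
     (real \<Rightarrow> complex) \<Rightarrow> (real \<Rightarrow> complex) \<Rightarrow> bool" where
  "is_adjoint_value p q T \<psi> v \<longleftrightarrow>
     \<psi> \<in> Lp p \<and> v \<in> Lp p \<and>
     (\<forall>f \<in> Lp q. (LINT x|lborel. T f x * \<psi> x) = (LINT x|lborel. f x * v x))"

definition layer_potential :: "real \<Rightarrow> (real \<Rightarrow> complex) \<Rightarrow> real \<Rightarrow> real \<Rightarrow> complex" where
  "layer_potential k \<psi> t x =
     1 / (2 * of_real pi) *
     (LINT y|lborel.
        of_real ((t - (x - y) * k * sgn y) / (t\<^sup>2 + (x - y)\<^sup>2)
                 - k * ((\<bar>x\<bar> + \<bar>y\<bar>) / (t\<^sup>2 + (\<bar>x\<bar> + \<bar>y\<bar>)\<^sup>2))) * \<psi> y)"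

text \<open>
  \<open>U\<close> is obtained from the datum \<open>u\<close> by the boundary equation method: \<open>U\<close> is the potential on the
  half plane $t > 0$ of a density $\psi \in L_p$ with $u = \frac12 (I+kK)^*\psi$.
\<close>

definition boundary_equation_solution ::
    "real \<Rightarrow> real \<Rightarrow> real \<Rightarrow> (real \<Rightarrow> complex) \<Rightarrow> (real \<Rightarrow> real \<Rightarrow> complex) \<Rightarrow> bool" where
  "boundary_equation_solution p q k u U \<longleftrightarrow>
     (\<exists>\<psi> v. is_adjoint_value p q (I_plus_kK k) \<psi> v \<and>
            (AE x in lborel. u x = 1 / 2 * v x) \<and>
            (\<forall>t x. t > 0 \<longrightarrow> U t x = layer_potential k \<psi> t x))"

end

theory Submission
  imports Defs
begin

text \<open>
  Write \<open>f\<close> for the kernel of the claimed formula, as a function of \<open>y\<close> with \<open>(t, x)\<close> fixed. It lies in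
  $L_q$ and $(I+kK)f$ is the kernel of the layer potential, so the definition of the adjoint turns
  $\int (I+kK)f\,\psi$ into $\int f\,(I+kK)^*\psi = 2\int f u$.

  To compute $Kf$, note that \<open>K\<close> acts on each half line separately, as $y \mapsto \frac1\pi\,\mathrm{p.v.}
  \int_0^\infty \frac{2s\,f(s)}{y^2-s^2}\,ds$. With $z=|x|+it$ and $A=-iz$ the function \<open>f\<close> is, on a half line,
  the imaginary part of a combination of $s/(s^2+A^2)$ and $s^{-\alpha}/(s^2+A^2)$, the first being the second
  for $\alpha=-1$. The principal value is the limit of its conjugate Poisson regularization, which is a
  combination of integrals of $s^{1-\alpha}/((s^2+A^2)(s^2+B^2))$ with $B=\varepsilon\pm iy$; these follow from
  $\int_0^\infty s^{1-\alpha}\bigl(\frac1{s^2+A^2}-\frac1{s^2+1}\bigr)ds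
  = \frac{\pi}{2\sin(\pi\alpha/2)}(A^{-\alpha}-1)$ for $\mathrm{Re}\,A>0$.
\<close>

section \<open>Power integrals on the half line\<close>

text \<open>The choice of \<alpha> is a cancellation. With z and A as above, f carries the term
  z^(\<alpha>+1) y^(-\<alpha>) / (y^2 + A^2), and kKf returns it multiplied by -k cot(pi \<alpha> /
  2), so tan(pi \<alpha> / 2) = k removes the power of y. What K adds besides is a multiple of
  z^(\<alpha>+1) A^(-\<alpha>). Since z = iA, this product is exp(i pi \<alpha> / 2) z, and division
  by cos(pi \<alpha> / 2) leaves (1 + ik) z, a term of the layer kernel. The interval for \<alpha>
  has length 2, the period of tan(pi \<alpha> / 2); the excluded value of k belongs to its end
  points. It is also the range in which y^(-\<alpha>) / (1 + y^2) is in L_q. It contains negative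
  \<alpha>, for which the integral of s^(1-\<alpha>) / (s^2 + A^2) diverges; this is why 1 / (s^2 +
  1) is subtracted. The subtracted integral is found from a first-order differential equation in A.
  For \<epsilon> = 0 the parameter B lies on the imaginary axis and the integrand has a pole on the
  half line. The closed form is continuous there, so the limit is taken in it.\<close>

abbreviation half_line :: "real measure" where
  "half_line \<equiv> restrict_space lborel {0<..}"

text \<open>The substitution t = s^2 / (1 + s^2) carries the half line onto (0, 1) and turns the
  integrand into half of Euler's Beta integrand with exponents p and q.\<close>

lemma
  fixes a b :: real
  assumes "a > -1" "2 * b > a + 1"
  shows integrable_powr_rational: "integrable half_line (\<lambda>s. s powr a * (1 + s\<^sup>2) powr (-b))"
    and integral_powr_rational:
      "(LINT s|half_line. s powr a * (1 + s\<^sup>2) powr (-b)) = Beta ((a + 1) / 2) (b - (a + 1) / 2) / 2"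
proof -
  define p where "p = (a + 1) / 2"
  define q where "q = b - p"
  have pq: "p > 0" "q > 0" using assms by (auto simp: p_def q_def field_simps)
  define f :: "real \<Rightarrow> real" where "f t = t powr (p - 1) * (1 - t) powr (q - 1)" for t
  define g :: "real \<Rightarrow> real" where "g s = s\<^sup>2 / (1 + s\<^sup>2)" for s
  define g' :: "real \<Rightarrow> real" where "g' s = 2 * s / (1 + s\<^sup>2)\<^sup>2" for s
  have pos: "1 + s\<^sup>2 > 0" for s :: real by (simp add: add_pos_nonneg)
  have deriv: "(g has_field_derivative g' s) (at s within {0<..})" for s
    unfolding g_def g'_def
    by (rule derivative_eq_intros refl pos[THEN less_imp_neq, symmetric])+
      (use pos[of s] in \<open>simp add: field_simps power2_eq_square\<close>)
  have "inj_on g {0<..}"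
  proof (rule inj_onI)
    fix x y :: real assume "x \<in> {0<..}" "y \<in> {0<..}" "g x = g y"
    then show "x = y"
      using pos[of x] pos[of y] by (simp add: g_def field_simps)
  qed
  have image: "g ` {0<..} = {0<..<1}"
  proof (intro equalityI subsetI)
    fix t assume "t \<in> g ` {0<..}"
    then obtain s where s: "s > 0" "t = s\<^sup>2 / (1 + s\<^sup>2)" unfolding g_def by auto
    then show "t \<in> {0<..<1}" using pos[of s] by simp
  next
    fix t :: real assume t: "t \<in> {0<..<1}"
    then have "g (sqrt (t / (1 - t))) = t" by (simp add: g_def field_simps)
    moreover have "sqrt (t / (1 - t)) > 0" using t by simp
    ultimately show "t \<in> g ` {0<..}" by (metis greaterThan_iff image_eqI)
  qed
  have "f absolutely_integrable_on {0<..<1} \<and> integral {0<..<1} f = Beta p q"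
  proof -
    have "f absolutely_integrable_on {0..1}"
      using integrable_Beta[OF pq] unfolding set_integrable_def f_def[symmetric]
      by (subst integrable_completion) (auto simp: f_def)
    moreover have "f absolutely_integrable_on {0<..<1} \<longleftrightarrow> f absolutely_integrable_on {0..1}"
      by (rule absolutely_integrable_spike_set_eq)
         (rule negligible_subset[of "{0,1}"]; force)+
    moreover have "integral {0<..<1} f = integral {0..1} f"
      by (rule integral_spike_set)
         (rule negligible_subset[of "{0,1}"]; force)+
    moreover have "integral {0..1} f = Beta p q"
      unfolding f_def using has_integral_Beta_real[OF pq] by (rule integral_unique)
    ultimately show ?thesis by simp
  qed
  then have "(\<lambda>s. \<bar>g' s\<bar> * f (g s)) absolutely_integrable_on {0<..} \<and>
    integral {0<..} (\<lambda>s. \<bar>g' s\<bar> * f (g s)) = Beta p q"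
    using has_absolute_integral_change_of_variables_1'[of "{0<..}" g g' f "Beta p q", OF _ deriv \<open>inj_on g {0<..}\<close>]
    by (simp add: image)
  moreover have pt: "\<bar>g' s\<bar> * f (g s) = 2 * (s powr a * (1 + s\<^sup>2) powr (-b))" if "s \<in> {0<..}" for s
  proof -
    have s: "s > 0" using that by simp
    \<comment> \<open>In the logarithms of s and 1 + s^2 every factor is an exponential, so the
      identity reduces to a linear one between the exponents.\<close>
    define u where "u = ln s"
    define w where "w = ln (1 + s\<^sup>2)"
    have e: "s = exp u" "1 + s\<^sup>2 = exp w" using s pos[of s] by (simp_all add: u_def w_def)
    have gs: "g s = exp (2 * u - w)"
      unfolding g_def e(2) by (simp add: e(1) exp_diff exp_double)
    have g1: "1 - g s = exp (- w)"
      using pos[of s] by (simp add: g_def exp_minus flip: e(2)) (simp add: field_simps)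
    have g's: "\<bar>g' s\<bar> = 2 * exp (u - 2 * w)"
      using s pos[of s] by (simp add: g'_def e(2) exp_diff exp_double flip: e(1))
    have "\<bar>g' s\<bar> * f (g s) = 2 * exp (u - 2 * w + (p - 1) * (2 * u - w) + (q - 1) * (- w))"
      unfolding f_def g1 g's unfolding gs by (simp add: powr_def flip: exp_add)
    also have "u - 2 * w + (p - 1) * (2 * u - w) + (q - 1) * (- w) = a * u - b * w"
      by (simp add: q_def p_def field_simps)
    also have "2 * exp (a * u - b * w) = 2 * (s powr a * (1 + s\<^sup>2) powr (-b))"
      using s pos[of s] by (simp add: powr_def u_def w_def flip: exp_add)
    finally show ?thesis .
  qed
  ultimately have *: "(\<lambda>s. 2 * (s powr a * (1 + s\<^sup>2) powr (-b))) absolutely_integrable_on {0<..}"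
    "integral {0<..} (\<lambda>s. 2 * (s powr a * (1 + s\<^sup>2) powr (-b))) = Beta p q"
    using set_integrable_cong[OF refl refl, of "{0<..}" "\<lambda>s. \<bar>g' s\<bar> * f (g s)"
        "\<lambda>s. 2 * (s powr a * (1 + s\<^sup>2) powr (-b))" lebesgue]
      Henstock_Kurzweil_Integration.integral_cong[of "{0<..}" "\<lambda>s. \<bar>g' s\<bar> * f (g s)"
        "\<lambda>s. 2 * (s powr a * (1 + s\<^sup>2) powr (-b))"] pt
    by (auto simp del: set_integrable_mult_right_iff Henstock_Kurzweil_Integration.integral_mult_right)
  \<comment> \<open>The change of variables works with the completed measure
    \<open>lebesgue\<close>; Borel measurability of the integrand brings the result back to
    \<open>lborel\<close>.\<close>
  have "set_integrable lborel {0<..} (\<lambda>s. 2 * (s powr a * (1 + s\<^sup>2) powr (-b)))"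
    using *(1) unfolding set_integrable_def by (subst (asm) integrable_completion) auto
  then have si: "set_integrable lborel {0<..} (\<lambda>s. s powr a * (1 + s\<^sup>2) powr (-b))"
    by simp
  then show "integrable half_line (\<lambda>s. s powr a * (1 + s\<^sup>2) powr (-b))"
    by (subst integrable_restrict_space) (auto simp: set_integrable_def)
  have "(LINT s|half_line. s powr a * (1 + s\<^sup>2) powr (-b)) = integral {0<..} (\<lambda>s. s powr a * (1 + s\<^sup>2) powr (-b))"
    using set_borel_integral_eq_integral(2)[OF si]
    by (subst integral_restrict_space) (auto simp: set_lebesgue_integral_def)
  also have "\<dots> = Beta p q / 2"
    using *(2) by simp
  finally show "(LINT s|half_line. s powr a * (1 + s\<^sup>2) powr (-b)) = Beta ((a + 1) / 2) (b - (a + 1) / 2) / 2"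
    by (simp add: p_def q_def)
qed

lemma integrable_half_lineI:
  fixes F :: "real \<Rightarrow> 'a::{banach, second_countable_topology}"
  assumes "F \<in> borel_measurable borel" "a > -1" "2 * b > a + 1"
    and "\<And>s. s > 0 \<Longrightarrow> norm (F s) \<le> C * (s powr a * (1 + s\<^sup>2) powr (-b))"
  shows "integrable half_line F"
proof (rule Bochner_Integration.integrable_bound)
  show "integrable half_line (\<lambda>s. C * (s powr a * (1 + s\<^sup>2) powr (-b)))"
    using assms by (intro integrable_mult_right integrable_powr_rational)
  show "F \<in> borel_measurable half_line"
    using assms(1) by (intro measurable_restrict_space1) simp
  show "AE s in half_line. norm (F s) \<le> norm (C * (s powr a * (1 + s\<^sup>2) powr (-b)))"
    using assms(4) by (intro AE_I2) (auto simp: space_restrict_space intro: order_trans[OF _ abs_ge_self])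
qed

text \<open>The value is Beta(1 - \<alpha>/2, 1 + \<alpha>/2) / 2, evaluated by the reflection
  formula for Gamma. It becomes the constant term of the differential equation for
  \<open>powr_kernel\<close>.\<close>

lemma integral_powr_kernel_one:
  fixes \<alpha> :: real
  assumes "-2 < \<alpha>" "\<alpha> < 2" "\<alpha> \<noteq> 0"
  shows "(LINT s|half_line. s powr (1 - \<alpha>) * (1 + s\<^sup>2) powr (-2)) = pi * \<alpha> / (4 * sin (pi * \<alpha> / 2))"
proof -
  define b where "b = \<alpha> / 2"
  have b: "-1 < b" "b < 1" "b \<noteq> 0" using assms by (auto simp: b_def)
  \<comment> \<open>The reflection formula is applied over the complex numbers and then read off for
    the real b.\<close>
  have "complex_of_real (Gamma b * Gamma (- b)) = Gamma (of_real b) * Gamma (- of_real b)"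
    by (simp add: Gamma_complex_of_real flip: of_real_minus)
  also have "\<dots> = of_real (- pi / (b * sin (pi * b)))"
    unfolding Gamma_reflection_complex' by (simp add: sin_of_real[symmetric])
  finally have *: "complex_of_real (Gamma b * Gamma (- b)) = of_real (- pi / (b * sin (pi * b)))" .
  have G: "Gamma b * Gamma (- b) = - pi / (b * sin (pi * b))"
    using * unfolding of_real_eq_iff .
  have nz: "b \<notin> \<int>\<^sub>\<le>\<^sub>0" "-b \<notin> \<int>\<^sub>\<le>\<^sub>0"
  proof -
    have "b \<notin> \<int>" using b by (auto elim!: Ints_cases)
    then show "b \<notin> \<int>\<^sub>\<le>\<^sub>0" "-b \<notin> \<int>\<^sub>\<le>\<^sub>0"
      using nonpos_Ints_Int minus_in_Ints_iff[of b] by blast+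
  qed
  have "Beta (1 - b) (1 + b) = Gamma (1 - b) * Gamma (1 + b)"
    by (simp add: Beta_def Gamma_numeral)
  also have "\<dots> = - b\<^sup>2 * (Gamma b * Gamma (-b))"
    using Gamma_plus1[OF nz(1)] Gamma_plus1[OF nz(2)]
    by (simp add: add.commute power2_eq_square)
  also have "\<dots> = pi * b / sin (pi * b)"
    using b unfolding G by (simp add: power2_eq_square)
  finally have "Beta (1 - b) (1 + b) = pi * b / sin (pi * b)" .
  moreover have eq: "(1 - \<alpha> + 1) / 2 = 1 - b" "2 - (1 - b) = 1 + b" by (auto simp: b_def field_simps)
  moreover have "(LINT s|half_line. s powr (1 - \<alpha>) * (1 + s\<^sup>2) powr (-2)) =
      Beta ((1 - \<alpha> + 1) / 2) (2 - (1 - \<alpha> + 1) / 2) / 2"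
    by (rule integral_powr_rational) (use assms in auto)
  ultimately show ?thesis
    unfolding eq by (simp add: b_def)
qed

text \<open>Dominated convergence along a filter reduces to sequences. Domination holds only
  eventually, so each sequence is shifted by some N first.\<close>

lemma tendsto_integral_at_within:
  fixes f :: "'a \<Rightarrow> 'b::{banach, second_countable_topology}"
    and F :: "'c::first_countable_topology \<Rightarrow> 'a \<Rightarrow> 'b"
  assumes "\<And>h. F h \<in> borel_measurable M" "f \<in> borel_measurable M" "integrable M w"
    and "AE z in M. ((\<lambda>h. F h z) \<longlongrightarrow> f z) (at x within S)"
    and "\<forall>\<^sub>F h in at x within S. AE z in M. norm (F h z) \<le> w z"
  shows "((\<lambda>h. integral\<^sup>L M (F h)) \<longlongrightarrow> integral\<^sup>L M f) (at x within S)"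
  unfolding tendsto_at_iff_sequentially comp_def
proof (intro allI impI)
  fix X assume X: "\<forall>i. X i \<in> S - {x}" "X \<longlonglongrightarrow> x"
  have flim: "filterlim X (at x within S) sequentially"
    using X by (auto simp: filterlim_at)
  obtain N where N: "\<And>n. n \<ge> N \<Longrightarrow> AE z in M. norm (F (X n) z) \<le> w z"
    using flim assms(5) unfolding filterlim_iff eventually_sequentially by blast
  have "(\<lambda>n. integral\<^sup>L M (F (X (n + N)))) \<longlonglongrightarrow> integral\<^sup>L M f"
  proof (rule integral_dominated_convergence)
    show "AE z in M. (\<lambda>n. F (X (n + N)) z) \<longlonglongrightarrow> f z"
      using assms(4)
    proof eventually_elim
      case (elim z)
      show ?case
        by (rule filterlim_compose[OF elim filterlim_compose[OF flim filterlim_add_const_nat_at_top]])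
    qed
    show "AE z in M. norm (F (X (n + N)) z) \<le> w z" for n
      by (rule N) simp
  qed (use assms in auto)
  then show "(\<lambda>n. integral\<^sup>L M (F (X n))) \<longlonglongrightarrow> integral\<^sup>L M f"
    by (rule LIMSEQ_offset)
qed

text \<open>The constant depends only on r and R, so one integrable majorant serves for all A in a
  compact part of the right half plane. For large s the term s^2 dominates; for small s the factors
  of s^2 + A^2 stay away from 0 because Re A does.\<close>

lemma norm_square_add_lower_bound:
  fixes A :: complex
  assumes "0 < r" "r \<le> Re A" "norm A \<le> R"
  shows "r\<^sup>2 / (1 + 2 * R\<^sup>2) * (1 + s\<^sup>2) \<le> norm ((of_real s)\<^sup>2 + A\<^sup>2)"
proof (cases "2 * R\<^sup>2 \<le> s\<^sup>2")
  case True
  have "r \<le> R" using assms complex_Re_le_cmod[of A] by linarith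
  then have "r\<^sup>2 * (1 + s\<^sup>2) \<le> R\<^sup>2 * (1 + s\<^sup>2)"
    using assms by (intro mult_right_mono power_mono) auto
  \<comment> \<open>The difference of the two sides is (s^2 - 2 R^2)(1 + R^2), which explains the
    threshold 2 R^2 of the case distinction.\<close>
  also have "\<dots> \<le> (s\<^sup>2 - R\<^sup>2) * (1 + 2 * R\<^sup>2)"
  proof -
    have "0 \<le> (s\<^sup>2 - 2 * R\<^sup>2) * (1 + R\<^sup>2)" using True by (intro mult_nonneg_nonneg) auto
    then show ?thesis by (simp add: algebra_simps)
  qed
  finally have "r\<^sup>2 / (1 + 2 * R\<^sup>2) * (1 + s\<^sup>2) \<le> s\<^sup>2 - R\<^sup>2"
    by (simp add: pos_divide_le_eq add_pos_nonneg)
  also have "\<dots> \<le> s\<^sup>2 - (norm A)\<^sup>2" using assms by (simp add: power_mono)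
  also have "\<dots> \<le> norm ((of_real s)\<^sup>2 + A\<^sup>2)"
    using norm_diff_ineq[of "(of_real s)\<^sup>2" "A\<^sup>2"] by (simp add: norm_power)
  finally show ?thesis .
next
  case False
  have "r\<^sup>2 / (1 + 2 * R\<^sup>2) * (1 + s\<^sup>2) \<le> r\<^sup>2 / (1 + 2 * R\<^sup>2) * (1 + 2 * R\<^sup>2)"
    using False by (intro mult_left_mono) auto
  also have "\<dots> = r\<^sup>2"
    using add_pos_nonneg[of 1 "2 * R\<^sup>2"] by simp
  also have "\<dots> \<le> (Re A)\<^sup>2" using assms by (intro power_mono) auto
  \<comment> \<open>s^2 + A^2 = (s + iA)(s - iA), and for real s the factors have imaginary parts Re
    A and -Re A.\<close>
  also have "\<dots> = \<bar>Im (of_real s + \<i> * A)\<bar> * \<bar>Im (of_real s - \<i> * A)\<bar>"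
    by (simp add: power2_eq_square flip: abs_mult)
  also have "\<dots> \<le> norm (of_real s + \<i> * A) * norm (of_real s - \<i> * A)"
    by (intro mult_mono abs_Im_le_cmod) auto
  also have "\<dots> = norm ((of_real s)\<^sup>2 + A\<^sup>2)"
    by (simp add: algebra_simps power2_eq_square flip: norm_mult)
  finally show ?thesis .
qed

lemma square_add_nonzero:
  fixes A :: complex
  assumes "0 < Re A"
  shows "(of_real s)\<^sup>2 + A\<^sup>2 \<noteq> 0"
proof
  assume "(of_real s)\<^sup>2 + A\<^sup>2 = 0"
  with norm_square_add_lower_bound[OF assms order_refl order_refl, of s]
  have "(Re A)\<^sup>2 / (1 + 2 * (norm A)\<^sup>2) * (1 + s\<^sup>2) \<le> 0" by simp
  moreover have "(Re A)\<^sup>2 / (1 + 2 * (norm A)\<^sup>2) * (1 + s\<^sup>2) > 0"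
    using assms by (intro mult_pos_pos divide_pos_pos add_pos_nonneg) auto
  ultimately show False by simp
qed

text \<open>Without the subtracted term the integral converges only for 0 < \<alpha> < 2. The
  difference decays like s^(-3-\<alpha>), which extends the range to -2 < \<alpha> < 2 and admits
  \<alpha> = -1. The subtraction also normalizes the value at A = 1 to 0.\<close>

definition powr_kernel :: "real \<Rightarrow> complex \<Rightarrow> complex" where
  "powr_kernel \<alpha> A =
     (LINT s|half_line. of_real (s powr (1 - \<alpha>)) * (1 / ((of_real s)\<^sup>2 + A\<^sup>2) - 1 / ((of_real s)\<^sup>2 + 1)))"

lemma powr_minus_two: "0 < x \<Longrightarrow> x powr (-2) = 1 / x\<^sup>2" for x :: real
  by (simp add: powr_minus divide_inverse)

lemma pair_kernel_bound:
  fixes A B :: complex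
  assumes "0 < r" "r \<le> Re A" "norm A \<le> R" "r \<le> Re B" "norm B \<le> R"
  shows "norm (of_real (s powr a) * (c / (((of_real s)\<^sup>2 + A\<^sup>2) * ((of_real s)\<^sup>2 + B\<^sup>2))))
    \<le> norm c * ((1 + 2 * R\<^sup>2) / r\<^sup>2)\<^sup>2 * (s powr a * (1 + s\<^sup>2) powr (-2))"
proof -
  have pos: "1 + s\<^sup>2 > 0" "1 + 2 * R\<^sup>2 > 0" by (auto simp: add_pos_nonneg)
  let ?k = "r\<^sup>2 / (1 + 2 * R\<^sup>2) * (1 + s\<^sup>2)"
  have k: "?k > 0" using assms pos by simp
  have "norm (of_real (s powr a) * (c / (((of_real s)\<^sup>2 + A\<^sup>2) * ((of_real s)\<^sup>2 + B\<^sup>2))))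
    = s powr a * (norm c / (norm ((of_real s)\<^sup>2 + A\<^sup>2) * norm ((of_real s)\<^sup>2 + B\<^sup>2)))"
    by (simp add: norm_mult norm_divide)
  also have "\<dots> \<le> s powr a * (norm c / (?k * ?k))"
  proof -
    note le = norm_square_add_lower_bound[OF assms(1,2,3), of s] norm_square_add_lower_bound[OF assms(1,4,5), of s]
    show ?thesis
      by (rule mult_left_mono[OF divide_left_mono[OF mult_mono[OF le]]])
        (use k le in \<open>auto intro!: mult_pos_pos simp del: times_divide_eq_left\<close>)
  qed
  also have "norm c / (?k * ?k) = norm c * ((1 + 2 * R\<^sup>2) / r\<^sup>2)\<^sup>2 * (1 + s\<^sup>2) powr (-2)"
    using pos assms by (simp add: powr_minus_two power2_eq_square)
  finally show ?thesis by (simp add: mult_ac)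
qed

lemma integrable_pair_kernel:
  fixes A B :: complex
  assumes "-2 < \<alpha>" "\<alpha> < 2" "0 < Re A" "0 < Re B"
  shows "integrable half_line
    (\<lambda>s. of_real (s powr (1 - \<alpha>)) * (c / (((of_real s)\<^sup>2 + A\<^sup>2) * ((of_real s)\<^sup>2 + B\<^sup>2))))"
proof (rule integrable_half_lineI)
  show "norm (of_real (s powr (1 - \<alpha>)) * (c / (((of_real s)\<^sup>2 + A\<^sup>2) * ((of_real s)\<^sup>2 + B\<^sup>2))))
    \<le> norm c * ((1 + 2 * (max (norm A) (norm B))\<^sup>2) / (min (Re A) (Re B))\<^sup>2)\<^sup>2 *
        (s powr (1 - \<alpha>) * (1 + s\<^sup>2) powr (-2))" for s
    by (rule pair_kernel_bound) (use assms in auto)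
qed (use assms in auto)

lemma inverse_square_add_diff:
  fixes A B :: complex
  assumes "0 < Re A" "0 < Re B"
  shows "1 / ((of_real s)\<^sup>2 + A\<^sup>2) - 1 / ((of_real s)\<^sup>2 + B\<^sup>2) =
    (B\<^sup>2 - A\<^sup>2) / (((of_real s)\<^sup>2 + A\<^sup>2) * ((of_real s)\<^sup>2 + B\<^sup>2))"
  using square_add_nonzero[OF assms(1), of s] square_add_nonzero[OF assms(2), of s]
  by (simp add: field_simps)

text \<open>In a difference of two values the normalizing term cancels. The resulting identity is
  used twice: as an exact difference quotient, and to recover the integral with two quadratic
  factors.\<close>

lemma
  fixes A B :: complex
  assumes "-2 < \<alpha>" "\<alpha> < 2" "0 < Re A" "0 < Re B"
  shows integrable_powr_kernel: "integrable half_line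
      (\<lambda>s. of_real (s powr (1 - \<alpha>)) * (1 / ((of_real s)\<^sup>2 + A\<^sup>2) - 1 / ((of_real s)\<^sup>2 + B\<^sup>2)))"
    and powr_kernel_diff: "powr_kernel \<alpha> A - powr_kernel \<alpha> B =
      (B\<^sup>2 - A\<^sup>2) *
        (LINT s|half_line. of_real (s powr (1 - \<alpha>)) / (((of_real s)\<^sup>2 + A\<^sup>2) * ((of_real s)\<^sup>2 + B\<^sup>2)))"
proof -
  have int: "integrable half_line
      (\<lambda>s. of_real (s powr (1 - \<alpha>)) * (1 / ((of_real s)\<^sup>2 + A\<^sup>2) - 1 / ((of_real s)\<^sup>2 + B\<^sup>2)))"
    if "0 < Re A" "0 < Re B" for A B
    unfolding inverse_square_add_diff[OF that] by (rule integrable_pair_kernel) (use assms that in auto)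
  then show "integrable half_line
      (\<lambda>s. of_real (s powr (1 - \<alpha>)) * (1 / ((of_real s)\<^sup>2 + A\<^sup>2) - 1 / ((of_real s)\<^sup>2 + B\<^sup>2)))"
    using assms by simp
  have "powr_kernel \<alpha> A - powr_kernel \<alpha> B =
    (LINT s|half_line. of_real (s powr (1 - \<alpha>)) * (1 / ((of_real s)\<^sup>2 + A\<^sup>2) - 1 / ((of_real s)\<^sup>2 + B\<^sup>2)))"
    unfolding powr_kernel_def using int[of A 1] int[of B 1] assms
    by (subst Bochner_Integration.integral_diff[symmetric])
      (simp_all add: algebra_simps)
  also have "\<dots> = (LINT s|half_line. (B\<^sup>2 - A\<^sup>2) *
      (of_real (s powr (1 - \<alpha>)) / (((of_real s)\<^sup>2 + A\<^sup>2) * ((of_real s)\<^sup>2 + B\<^sup>2))))"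
    unfolding inverse_square_add_diff[OF assms(3,4)] by (simp only: times_divide_eq_right mult.commute)
  also have "\<dots> = (B\<^sup>2 - A\<^sup>2) *
      (LINT s|half_line. of_real (s powr (1 - \<alpha>)) / (((of_real s)\<^sup>2 + A\<^sup>2) * ((of_real s)\<^sup>2 + B\<^sup>2)))"
    by (rule integral_mult_right_zero)
  finally show "powr_kernel \<alpha> A - powr_kernel \<alpha> B =
      (B\<^sup>2 - A\<^sup>2) *
        (LINT s|half_line. of_real (s powr (1 - \<alpha>)) / (((of_real s)\<^sup>2 + A\<^sup>2) * ((of_real s)\<^sup>2 + B\<^sup>2)))" .
qed

text \<open>By \<open>powr_kernel_diff\<close> the difference quotient is exactly -(A + B) times an
  integral with two quadratic factors, so differentiating amounts to letting B tend to A under that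
  integral.\<close>

lemma has_field_derivative_powr_kernel:
  fixes A :: complex
  assumes "-2 < \<alpha>" "\<alpha> < 2" "0 < Re A"
  shows "(powr_kernel \<alpha> has_field_derivative
    - 2 * A * (LINT s|half_line. of_real (s powr (1 - \<alpha>)) / ((of_real s)\<^sup>2 + A\<^sup>2)\<^sup>2)) (at A)"
  unfolding has_field_derivative_iff
proof -
  \<comment> \<open>In the disc of radius r about A the real part stays above r and the modulus
    below R, as the uniform lower bound requires.\<close>
  define r where "r = Re A / 2"
  define R where "R = norm A + r"
  have r: "r > 0" "r \<le> Re A" "norm A \<le> R" using assms by (auto simp: r_def R_def)
  have near: "\<forall>\<^sub>F B in at A. dist B A < r" "\<forall>\<^sub>F B in at A. B \<noteq> A"
    using r by (auto simp: eventually_at intro!: exI[of _ r])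
  have B: "r \<le> Re B" "norm B \<le> R" if "dist B A < r" for B
  proof -
    have "\<bar>Re (B - A)\<bar> < r" using that abs_Re_le_cmod[of "B - A"] by (simp add: dist_norm)
    then show "r \<le> Re B" by (auto simp: r_def abs_if split: if_splits)
    show "norm B \<le> R" using that norm_triangle_sub[of B A] by (simp add: R_def dist_norm)
  qed
  have "((\<lambda>B. LINT s|half_line. of_real (s powr (1 - \<alpha>)) * (-1 / (((of_real s)\<^sup>2 + A\<^sup>2) * ((of_real s)\<^sup>2 + B\<^sup>2)))) \<longlongrightarrow>
      (LINT s|half_line. of_real (s powr (1 - \<alpha>)) * (-1 / (((of_real s)\<^sup>2 + A\<^sup>2) * ((of_real s)\<^sup>2 + A\<^sup>2))))) (at A)"
  proof (rule tendsto_integral_at_within)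
    show "integrable half_line
        (\<lambda>s. norm (-1::complex) * ((1 + 2 * R\<^sup>2) / r\<^sup>2)\<^sup>2 * (s powr (1 - \<alpha>) * (1 + s\<^sup>2) powr (-2)))"
      using assms by (intro integrable_mult_right integrable_powr_rational) auto
    show "\<forall>\<^sub>F B in at A. AE s in half_line.
       norm (of_real (s powr (1 - \<alpha>)) * (-1 / (((of_real s)\<^sup>2 + A\<^sup>2) * ((of_real s)\<^sup>2 + B\<^sup>2))))
       \<le> norm (-1::complex) * ((1 + 2 * R\<^sup>2) / r\<^sup>2)\<^sup>2 * (s powr (1 - \<alpha>) * (1 + s\<^sup>2) powr (-2))"
      using near(1) by eventually_elim (intro AE_I2 pair_kernel_bound r B)
    show "AE s in half_line. ((\<lambda>B. of_real (s powr (1 - \<alpha>)) * (-1 / (((of_real s)\<^sup>2 + A\<^sup>2) * ((of_real s)\<^sup>2 + B\<^sup>2))))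
       \<longlongrightarrow> of_real (s powr (1 - \<alpha>)) * (-1 / (((of_real s)\<^sup>2 + A\<^sup>2) * ((of_real s)\<^sup>2 + A\<^sup>2)))) (at A)"
      using square_add_nonzero[OF assms(3)] by (intro AE_I2 tendsto_intros) auto
  qed (intro measurable_restrict_space1; measurable)+
  then have "((\<lambda>B. (A + B) * (LINT s|half_line. of_real (s powr (1 - \<alpha>)) * (-1 / (((of_real s)\<^sup>2 + A\<^sup>2) * ((of_real s)\<^sup>2 + B\<^sup>2))))) \<longlongrightarrow>
      (A + A) * (LINT s|half_line. of_real (s powr (1 - \<alpha>)) * (-1 / (((of_real s)\<^sup>2 + A\<^sup>2) * ((of_real s)\<^sup>2 + A\<^sup>2))))) (at A)"
    by (intro tendsto_intros)
  also have "(A + A) * (LINT s|half_line. of_real (s powr (1 - \<alpha>)) * (-1 / (((of_real s)\<^sup>2 + A\<^sup>2) * ((of_real s)\<^sup>2 + A\<^sup>2)))) =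
     - 2 * A * (LINT s|half_line. of_real (s powr (1 - \<alpha>)) / ((of_real s)\<^sup>2 + A\<^sup>2)\<^sup>2)"
    by (simp add: power2_eq_square)
  finally have lim: "((\<lambda>B. (A + B) * (LINT s|half_line. of_real (s powr (1 - \<alpha>)) * (-1 / (((of_real s)\<^sup>2 + A\<^sup>2) * ((of_real s)\<^sup>2 + B\<^sup>2))))) \<longlongrightarrow>
     - 2 * A * (LINT s|half_line. of_real (s powr (1 - \<alpha>)) / ((of_real s)\<^sup>2 + A\<^sup>2)\<^sup>2)) (at A)" .
  show "((\<lambda>B. (powr_kernel \<alpha> B - powr_kernel \<alpha> A) / (B - A)) \<longlongrightarrow>
     - 2 * A * (LINT s|half_line. of_real (s powr (1 - \<alpha>)) / ((of_real s)\<^sup>2 + A\<^sup>2)\<^sup>2)) (at A)"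
  proof (rule Lim_transform_eventually[OF lim])
    show "\<forall>\<^sub>F B in at A. (A + B) * (LINT s|half_line. of_real (s powr (1 - \<alpha>)) * (-1 / (((of_real s)\<^sup>2 + A\<^sup>2) * ((of_real s)\<^sup>2 + B\<^sup>2))))
       = (powr_kernel \<alpha> B - powr_kernel \<alpha> A) / (B - A)"
      using near
    proof eventually_elim
      case (elim C)
      define I where "I = (LINT s|half_line. of_real (s powr (1 - \<alpha>)) / (((of_real s)\<^sup>2 + A\<^sup>2) * ((of_real s)\<^sup>2 + C\<^sup>2)))"
      have "powr_kernel \<alpha> A - powr_kernel \<alpha> C = (C\<^sup>2 - A\<^sup>2) * I"
        unfolding I_def by (rule powr_kernel_diff) (use assms r B[OF elim(1)] in auto)
      then have "(powr_kernel \<alpha> C - powr_kernel \<alpha> A) / (C - A) = (A + C) * (- I)"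
        using elim(2) by (simp add: divide_eq_eq) (simp add: power2_eq_square algebra_simps)
      also have "- I = (LINT s|half_line. of_real (s powr (1 - \<alpha>)) * (-1 / (((of_real s)\<^sup>2 + A\<^sup>2) * ((of_real s)\<^sup>2 + C\<^sup>2))))"
        unfolding I_def by simp
      finally show ?case by simp
    qed
  qed
qed

section \<open>The differential equation in \<open>A\<close> and its solution\<close>

lemma integrable_half_line_iff: "integrable half_line f \<longleftrightarrow> set_integrable lborel {0<..} f"
  for f :: "real \<Rightarrow> 'a::{banach, second_countable_topology}"
  by (subst integrable_restrict_space) (auto simp: set_integrable_def)

lemma integral_half_line_eq: "integral\<^sup>L half_line f = (LINT s:{0<..}|lborel. f s)"
  for f :: "real \<Rightarrow> 'a::{banach, second_countable_topology}"
  by (subst integral_restrict_space) (auto simp: set_lebesgue_integral_def)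

text \<open>
  The integral over \<open>{0<..}\<close> of the derivative of
  \<open>s powr (2 - \<alpha>) * (1 / (s\<^sup>2 + A\<^sup>2) - 1 / (s\<^sup>2 + 1))\<close> vanishes; this turns into a first-order
  differential equation in \<open>A\<close>.
\<close>

lemma powr_kernel_ode:
  fixes A :: complex
  assumes "-2 < \<alpha>" "\<alpha> < 2" "\<alpha> \<noteq> 0" "0 < Re A"
  shows "A * (- 2 * A * (LINT s|half_line. of_real (s powr (1 - \<alpha>)) / ((of_real s)\<^sup>2 + A\<^sup>2)\<^sup>2)) =
    - of_real \<alpha> * (powr_kernel \<alpha> A + of_real (pi / (2 * sin (pi * \<alpha> / 2))))"
proof -
  define T1 where "T1 s = of_real (s powr (1 - \<alpha>)) * (1 / ((of_real s)\<^sup>2 + A\<^sup>2) - 1 / ((of_real s)\<^sup>2 + 1))" for s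
  define T2 where "T2 s = of_real (s powr (1 - \<alpha>)) / ((of_real s)\<^sup>2 + A\<^sup>2)\<^sup>2" for s
  define T3 :: "real \<Rightarrow> complex" where "T3 s = of_real (s powr (1 - \<alpha>)) / ((of_real s)\<^sup>2 + 1)\<^sup>2" for s
  define f where "f s = - of_real \<alpha> * T1 s + 2 * A\<^sup>2 * T2 s - 2 * T3 s" for s
  define F where "F s = of_real (s powr (2 - \<alpha>)) * (1 / ((of_real s)\<^sup>2 + A\<^sup>2) - 1 / ((of_real s)\<^sup>2 + 1))" for s
  note nzA = square_add_nonzero[OF assms(4)]
  have nz1: "(of_real s)\<^sup>2 + 1 \<noteq> (0::complex)" for s :: real
    using square_add_nonzero[of 1 s] by simp
  have int1: "integrable half_line T1"
    using integrable_powr_kernel[of \<alpha> A 1] assms by (simp add: T1_def[abs_def])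
  have int2: "integrable half_line T2"
    using integrable_pair_kernel[of \<alpha> A A 1] assms by (simp add: T2_def[abs_def] power2_eq_square)
  have int3: "integrable half_line T3"
    using integrable_pair_kernel[of \<alpha> 1 1 1] assms by (simp add: T3_def[abs_def] power2_eq_square)
  have "(LINT s|half_line. f s) = 0"
  proof -
    \<comment> \<open>The majorant behaves like s^(2-\<alpha>) at 0 and like s^(-2-\<alpha>) at
      infinity, so both boundary terms vanish for -2 < \<alpha> < 2.\<close>
    have bound: "norm (F s) \<le> norm (1 - A\<^sup>2) * ((1 + 2 * (max (norm A) 1)\<^sup>2) / (min (Re A) 1)\<^sup>2)\<^sup>2 *
        (s powr (2 - \<alpha>) * (1 + s\<^sup>2) powr (-2))" for s
      unfolding F_def using inverse_square_add_diff[OF assms(4), of 1 s]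
        pair_kernel_bound[of "min (Re A) 1" A "max (norm A) 1" 1 s "2 - \<alpha>" "1 - A\<^sup>2"] assms(4)
      by simp
    have small: "((\<lambda>s. s powr (2 - \<alpha>) * (1 + s\<^sup>2) powr (-2)) \<longlongrightarrow> 0) (at_right 0)"
    proof -
      have "((\<lambda>s. s powr (2 - \<alpha>) * (1 + s\<^sup>2) powr (-2)) \<longlongrightarrow> 0 * (1 + 0\<^sup>2) powr (-2)) (at_right (0::real))"
        using assms by (intro tendsto_mult tendsto_zero_powrI[of _ _ _ "2 - \<alpha>"] tendsto_powr tendsto_intros)
          (auto simp: eventually_at_filter)
      then show ?thesis by simp
    qed
    have large: "((\<lambda>s. s powr (2 - \<alpha>) * (1 + s\<^sup>2) powr (-2)) \<longlongrightarrow> 0) at_top"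
    proof (rule Lim_null_comparison)
      show "\<forall>\<^sub>F s in at_top. norm (s powr (2 - \<alpha>) * (1 + s\<^sup>2) powr (-2)) \<le> s powr (- (2 + \<alpha>))"
        using eventually_gt_at_top[of "0::real"]
      proof eventually_elim
        case (elim s)
        have "(1 + s\<^sup>2) powr (-2) \<le> (s powr 2) powr (-2)"
          using elim by (intro powr_mono2') auto
        also have "\<dots> = s powr (-4)" by (simp add: powr_powr)
        finally have "s powr (2 - \<alpha>) * (1 + s\<^sup>2) powr (-2) \<le> s powr (2 - \<alpha>) * s powr (-4)"
          by (intro mult_left_mono) auto
        also have "\<dots> = s powr (- (2 + \<alpha>))" by (simp flip: powr_add)
        finally show ?case by simp
      qed
      show "((\<lambda>s. s powr (- (2 + \<alpha>))) \<longlongrightarrow> 0) at_top"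
        using assms by (intro tendsto_neg_powr filterlim_ident) auto
    qed
    have "(LBINT s=0..\<infinity>. f s) = 0 - 0"
    proof (rule interval_integral_FTC_integrable[where F = F])
      show "(F has_vector_derivative f s) (at s)" if "0 < ereal s" for s
      proof -
        have s: "s > 0" using that by simp
        define P where "P = 1 / ((of_real s)\<^sup>2 + A\<^sup>2)"
        define R where "R = 1 / ((of_real s)\<^sup>2 + 1 :: complex)"
        \<comment> \<open>These identities eliminate s^2 from the derivative of \<open>F\<close>,
          leaving s^(1-\<alpha>) times a polynomial in P and R, that is, the integrands
          \<open>T1\<close>, \<open>T2\<close> and \<open>T3\<close>.\<close>
        have P: "(of_real s)\<^sup>2 * P = 1 - A\<^sup>2 * P" and R: "(of_real s)\<^sup>2 * R = 1 - R"
          using nzA[of s] nz1[of s] by (simp_all add: P_def R_def field_simps)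
        have "((\<lambda>w. 1 / (w\<^sup>2 + A\<^sup>2) - 1 / (w\<^sup>2 + 1)) has_field_derivative
            - (2 * of_real s) * P\<^sup>2 + 2 * of_real s * R\<^sup>2) (at (of_real s))"
          using nzA[of s] nz1[of s]
          by (auto intro!: derivative_eq_intros simp: P_def R_def power2_eq_square)
        note D = has_vector_derivative_real_field[OF this, of UNIV]
        have "(F has_vector_derivative (of_real (s powr (2 - \<alpha>)) * (- (2 * of_real s) * P\<^sup>2 + 2 * of_real s * R\<^sup>2) +
           of_real ((2 - \<alpha>) * s powr (2 - \<alpha> - 1)) * (P - R))) (at s)"
          unfolding F_def P_def R_def using s
          by (intro has_vector_derivative_mult D[unfolded P_def R_def] has_vector_derivative_of_real
             has_real_derivative_powr)
        also have "of_real (s powr (2 - \<alpha>)) * (- (2 * of_real s) * P\<^sup>2 + 2 * of_real s * R\<^sup>2) +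
           of_real ((2 - \<alpha>) * s powr (2 - \<alpha> - 1)) * (P - R) =
          of_real (s powr (1 - \<alpha>)) * (2 * ((of_real s)\<^sup>2 * R) * R - 2 * ((of_real s)\<^sup>2 * P) * P + (2 - of_real \<alpha>) * (P - R))"
        proof -
          have "s powr (2 - \<alpha>) = s * s powr (1 - \<alpha>)"
            using s powr_add[of s 1 "1 - \<alpha>"] by simp
          then show ?thesis by (simp add: algebra_simps power2_eq_square)
        qed
        also have "\<dots> = of_real (s powr (1 - \<alpha>)) * (- of_real \<alpha> * (P - R) + 2 * A\<^sup>2 * P\<^sup>2 - 2 * R\<^sup>2)"
          unfolding P R by (simp add: algebra_simps power2_eq_square)
        also have "\<dots> = f s"
          by (simp add: f_def T1_def T2_def T3_def P_def R_def right_diff_distrib distrib_left power_divide mult_ac)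
        finally show ?thesis .
      qed
      show "isCont f s" if "0 < ereal s" for s
        unfolding f_def T1_def T2_def T3_def using that nzA[of s] nz1[of s]
        by (auto intro!: continuous_intros)
      show "set_integrable lborel (einterval 0 \<infinity>) f"
        using int1 int2 int3 unfolding f_def
        by (simp add: zero_ereal_def flip: integrable_half_line_iff)
      show "((F \<circ> real_of_ereal) \<longlongrightarrow> 0) (at_right 0)"
        unfolding zero_ereal_def ereal_tendsto_simps1
        by (rule Lim_null_comparison[OF always_eventually tendsto_mult_right_zero[OF small]])
          (use bound in blast)
      show "((F \<circ> real_of_ereal) \<longlongrightarrow> 0) (at_left \<infinity>)"
        unfolding ereal_tendsto_simps1
        by (rule Lim_null_comparison[OF always_eventually tendsto_mult_right_zero[OF large]])
          (use bound in blast)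
    qed auto
    then show ?thesis
      by (simp add: interval_lebesgue_integral_0_infty integral_half_line_eq)
  qed
  also have "(LINT s|half_line. f s) = - of_real \<alpha> * (LINT s|half_line. T1 s)
      + 2 * A\<^sup>2 * (LINT s|half_line. T2 s) - 2 * (LINT s|half_line. T3 s)"
    unfolding f_def using int1 int2 int3 by simp
  also have "(LINT s|half_line. T1 s) = powr_kernel \<alpha> A"
    by (simp add: powr_kernel_def T1_def)
  \<comment> \<open>\<open>T3\<close> does not involve A; its integral gives the inhomogeneous
    constant pi / (2 sin(pi \<alpha> / 2)).\<close>
  also have "(LINT s|half_line. T3 s) = of_real (pi * \<alpha> / (4 * sin (pi * \<alpha> / 2)))"
  proof -
    have "(LINT s|half_line. T3 s) = (LINT s|half_line. of_real (s powr (1 - \<alpha>) * (1 + s\<^sup>2) powr (-2)))"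
      by (intro Bochner_Integration.integral_cong)
        (auto simp: T3_def powr_minus_two add_pos_nonneg add.commute)
    also have "\<dots> = of_real (pi * \<alpha> / (4 * sin (pi * \<alpha> / 2)))"
      using integral_powr_kernel_one[OF assms(1-3)] by (simp del: of_real_mult)
    finally show ?thesis .
  qed
  finally show ?thesis
    using assms(3) unfolding T2_def by (simp add: power2_eq_square algebra_simps)
qed

text \<open>With e = pi / (2 sin(pi \<alpha> / 2)) the differential equation reads A J' = -\<alpha>
  (J + e), so (J + e) A^\<alpha> has derivative 0 on the convex half plane Re A > 0 and is constant
  there.\<close>

lemma powr_kernel_eq:
  fixes A :: complex
  assumes "-2 < \<alpha>" "\<alpha> < 2" "\<alpha> \<noteq> 0" "0 < Re A"
  shows "powr_kernel \<alpha> A = of_real (pi / (2 * sin (pi * \<alpha> / 2))) * (A powr (- of_real \<alpha>) - 1)"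
proof -
  define e :: complex where "e = of_real (pi / (2 * sin (pi * \<alpha> / 2)))"
  have "\<exists>c. \<forall>B\<in>{B. Re B > 0}. (powr_kernel \<alpha> B + e) * B powr of_real \<alpha> = c"
  proof (rule has_field_derivative_zero_constant)
    fix B assume "B \<in> {B. Re B > 0}"
    then have B: "Re B > 0" by simp
    define D where "D = - 2 * B * (LINT s|half_line. of_real (s powr (1 - \<alpha>)) / ((of_real s)\<^sup>2 + B\<^sup>2)\<^sup>2)"
    have BD: "B * D = - of_real \<alpha> * (powr_kernel \<alpha> B + e)"
      unfolding D_def e_def by (rule powr_kernel_ode) (use assms B in auto)
    have nz: "B \<notin> \<real>\<^sub>\<le>\<^sub>0" "B \<noteq> 0" using B by (auto simp: complex_nonpos_Reals_iff)
    have "((\<lambda>B. (powr_kernel \<alpha> B + e) * B powr of_real \<alpha>) has_field_derivative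
        (powr_kernel \<alpha> B + e) * (of_real \<alpha> * B powr (of_real \<alpha> - 1)) + D * B powr of_real \<alpha>) (at B)"
      using has_field_derivative_powr_kernel[OF assms(1,2) B] nz
      unfolding D_def[symmetric] by (auto intro!: derivative_eq_intros)
    also have "B powr of_real \<alpha> = B * B powr (of_real \<alpha> - 1)"
      using nz by (simp add: powr_diff)
    also have "(powr_kernel \<alpha> B + e) * (of_real \<alpha> * B powr (of_real \<alpha> - 1)) + D * (B * B powr (of_real \<alpha> - 1))
      = B powr (of_real \<alpha> - 1) * (of_real \<alpha> * (powr_kernel \<alpha> B + e) + B * D)"
      by (simp add: algebra_simps)
    also have "\<dots> = 0" unfolding BD by simp
    finally show "((\<lambda>B. (powr_kernel \<alpha> B + e) * B powr of_real \<alpha>) has_field_derivative 0) (at B within {B. Re B > 0})"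
      by (rule has_field_derivative_at_within)
  qed (rule convex_halfspace_Re_gt)
  then obtain c where c: "\<And>B. Re B > 0 \<Longrightarrow> (powr_kernel \<alpha> B + e) * B powr of_real \<alpha> = c"
    by auto
  \<comment> \<open>At B = 1 the two fractions in \<open>powr_kernel\<close> coincide and the
    integral is 0.\<close>
  have "c = e" using c[of 1] by (simp add: powr_kernel_def)
  then have "(powr_kernel \<alpha> A + e) * A powr of_real \<alpha> * A powr (- of_real \<alpha>) = e * A powr (- of_real \<alpha>)"
    using c[OF assms(4)] by simp
  moreover have "A powr of_real \<alpha> * A powr (- of_real \<alpha>) = 1"
    using assms(4) by (auto simp flip: powr_add)
  ultimately have "powr_kernel \<alpha> A + e = e * A powr (- of_real \<alpha>)"
    by (simp add: mult.assoc)
  then have "powr_kernel \<alpha> A = e * (A powr (- of_real \<alpha>) - 1)"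
    by (simp add: right_diff_distrib eq_diff_eq)
  then show ?thesis by (simp only: e_def)
qed

text \<open>\<open>powr_kernel_diff\<close> is solved for the integral, with both values of
  \<open>powr_kernel\<close> inserted; their constants -1 cancel.\<close>

lemma integral_pair_kernel:
  fixes A B :: complex
  assumes "-2 < \<alpha>" "\<alpha> < 2" "\<alpha> \<noteq> 0" "0 < Re A" "0 < Re B" "A\<^sup>2 \<noteq> B\<^sup>2"
  shows "(LINT s|half_line. of_real (s powr (1 - \<alpha>)) / (((of_real s)\<^sup>2 + A\<^sup>2) * ((of_real s)\<^sup>2 + B\<^sup>2))) =
    of_real (pi / (2 * sin (pi * \<alpha> / 2))) * (A powr (- of_real \<alpha>) - B powr (- of_real \<alpha>)) / (B\<^sup>2 - A\<^sup>2)"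
proof -
  define I where "I = (LINT s|half_line. of_real (s powr (1 - \<alpha>)) / (((of_real s)\<^sup>2 + A\<^sup>2) * ((of_real s)\<^sup>2 + B\<^sup>2)))"
  define e :: complex where "e = of_real (pi / (2 * sin (pi * \<alpha> / 2)))"
  have "e * (A powr (- of_real \<alpha>) - 1) - e * (B powr (- of_real \<alpha>) - 1) = (B\<^sup>2 - A\<^sup>2) * I"
    using powr_kernel_diff[OF assms(1,2,4,5)]
    unfolding powr_kernel_eq[OF assms(1-4)] powr_kernel_eq[OF assms(1-3,5)] e_def I_def .
  then have "I * (B\<^sup>2 - A\<^sup>2) = e * (A powr (- of_real \<alpha>) - B powr (- of_real \<alpha>))"
    by (simp add: algebra_simps)
  then have "I = e * (A powr (- of_real \<alpha>) - B powr (- of_real \<alpha>)) / (B\<^sup>2 - A\<^sup>2)"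
    using assms(6) by (subst eq_divide_eq) auto
  then show ?thesis by (simp only: I_def e_def)
qed

section \<open>Regularization of principal values\<close>

lemma integral_half_line_reflect_eq:
  fixes F :: "real \<Rightarrow> 'a::{banach, second_countable_topology}"
  assumes "\<And>s. s \<le> 0 \<Longrightarrow> F (\<sigma> * s) = 0" "\<bar>\<sigma>\<bar> = 1"
  shows "(LINT s|lborel. F s) = (LINT s|half_line. F (\<sigma> * s))"
proof -
  have "(LINT s|lborel. F s) = (LINT s|lborel. F (\<sigma> * s))"
    using lborel_integral_real_affine[of \<sigma> F 0] assms(2) by auto
  also have "\<dots> = (LINT s|lborel. indicator {0<..} s *\<^sub>R F (\<sigma> * s))"
    by (intro Bochner_Integration.integral_cong) (auto simp: indicator_def assms(1) not_less)
  also have "\<dots> = (LINT s|half_line. F (\<sigma> * s))"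
    by (subst integral_restrict_space) auto
  finally show ?thesis .
qed

text \<open>The reflection s -> 2y - s preserves the measure. Integrability need not be assumed,
  because the integral of a non-integrable function is 0 by convention.\<close>

lemma integral_odd_about:
  fixes F :: "real \<Rightarrow> 'a::{banach, second_countable_topology}"
  assumes "\<And>s. F (2 * y - s) = - F s"
  shows "(LINT s|lborel. F s) = 0"
proof -
  have "(LINT s|lborel. F s) = (LINT s|lborel. F (2 * y - s))"
    using lborel_integral_real_affine[of "-1" F "2 * y"] by simp
  also have "\<dots> = - (LINT s|lborel. F s)"
    unfolding assms by simp
  finally have "2 *\<^sub>R (LINT s|lborel. F s) = 0"
    by (simp add: scaleR_2 eq_neg_iff_add_eq_0)
  then show ?thesis by simp
qed

text \<open>The radius \<delta> is independent of \<epsilon>, so this single function dominates all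
  truncations and regularizations. At s = y it is 0, division by 0 being 0.\<close>

definition truncated_quotient :: "(real \<Rightarrow> complex) \<Rightarrow> real \<Rightarrow> real \<Rightarrow> real \<Rightarrow> complex" where
  "truncated_quotient f y \<delta> s = (f s - f y * indicator {y-\<delta><..<y+\<delta>} s) / of_real (y - s)"

text \<open>
  Subtracting the value at \<open>y\<close> on a symmetric interval does not change truncated or regularized
  integrals because their kernels are odd about \<open>y\<close>; the remaining integrand is dominated.
\<close>

lemma
  fixes f :: "real \<Rightarrow> complex" and y \<delta> :: real
  assumes [measurable]: "f \<in> borel_measurable borel" and "0 < \<delta>"
    and int: "integrable lborel (truncated_quotient f y \<delta>)"
  shows pv_integral_eq: "pv_integral f y = integral\<^sup>L lborel (truncated_quotient f y \<delta>)"
    and integrable_conjugate_poisson: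
      "0 < \<epsilon> \<Longrightarrow> integrable lborel (\<lambda>s. f s * of_real ((y - s) / ((y - s)\<^sup>2 + \<epsilon>\<^sup>2)))"
    and tendsto_conjugate_poisson:
      "((\<lambda>\<epsilon>. LINT s|lborel. f s * of_real ((y - s) / ((y - s)\<^sup>2 + \<epsilon>\<^sup>2))) \<longlongrightarrow> integral\<^sup>L lborel (truncated_quotient f y \<delta>)) (at_right 0)"
proof -
  define \<phi> :: "real \<Rightarrow> real" where "\<phi> = indicator {y-\<delta><..<y+\<delta>}"
  define g where "g = truncated_quotient f y \<delta>"
  have [measurable]: "\<phi> \<in> borel_measurable borel" by (simp add: \<phi>_def)
  have [measurable]: "g \<in> borel_measurable borel"
    using borel_measurable_integrable[OF int] by (simp add: g_def)
  have intg: "integrable lborel g" using int by (simp add: g_def)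
  \<comment> \<open>The remainder \<phi> s / (y - s) is odd about y and drops out of every symmetric
    integral. The identity also holds at s = y, where all three quotients are 0.\<close>
  have g: "f s / of_real (y - s) = g s + f y * of_real (\<phi> s / (y - s))" for s
    by (simp add: g_def truncated_quotient_def \<phi>_def indicator_def diff_divide_distrib)
  \<comment> \<open>The interval is symmetric, so \<phi> is even about y; its products with odd
    kernels are therefore odd.\<close>
  have \<phi>_odd: "\<phi> (2 * y - s) = \<phi> s" for s
    by (auto simp: \<phi>_def indicator_def)
  have \<phi>_int: "integrable lborel \<phi>"
    unfolding \<phi>_def by (intro integrable_real_indicator) (use assms(2) in auto)
  have at0: "\<forall>\<^sub>F \<epsilon> in at_right 0. 0 < (\<epsilon>::real)"
    by (simp add: eventually_at_right_less)

  have trunc: "(LINT s:{s. \<bar>y - s\<bar> > \<epsilon>}|lborel. f s / of_real (y - s)) =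
      (LINT s|lborel. indicator {s. \<bar>y - s\<bar> > \<epsilon>} s *\<^sub>R g s)" if "\<epsilon> > 0" for \<epsilon>
  proof -
    define h where "h s = indicator {s. \<bar>y - s\<bar> > \<epsilon>} s * \<phi> s / (y - s)" for s
    have [measurable]: "h \<in> borel_measurable borel" unfolding h_def by measurable
    have hint: "integrable lborel h"
    proof (rule Bochner_Integration.integrable_bound)
      show "integrable lborel (\<lambda>s. 1 / \<epsilon> * \<phi> s)" using \<phi>_int by simp
      show "AE s in lborel. norm (h s) \<le> norm (1 / \<epsilon> * \<phi> s)"
        using that by (intro AE_I2) (auto simp: h_def \<phi>_def indicator_def field_simps abs_if)
    qed simp
    have "indicator {s. \<bar>y - s\<bar> > \<epsilon>} s *\<^sub>R (f s / of_real (y - s)) =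
        indicator {s. \<bar>y - s\<bar> > \<epsilon>} s *\<^sub>R g s + f y * of_real (h s)" for s
      unfolding g by (simp add: h_def indicator_def)
    then have "(LINT s:{s. \<bar>y - s\<bar> > \<epsilon>}|lborel. f s / of_real (y - s)) =
      (LINT s|lborel. indicator {s. \<bar>y - s\<bar> > \<epsilon>} s *\<^sub>R g s + f y * of_real (h s))"
      by (simp add: set_lebesgue_integral_def)
    also have "\<dots> = (LINT s|lborel. indicator {s. \<bar>y - s\<bar> > \<epsilon>} s *\<^sub>R g s) + f y * of_real (LINT s|lborel. h s)"
      using hint intg
      by (subst Bochner_Integration.integral_add)
        (auto intro!: integrable_mult_indicator simp: integral_mult_right_zero)
    also have "(LINT s|lborel. h s) = 0"
      by (rule integral_odd_about[of _ y])
        (simp add: h_def \<phi>_odd indicator_def abs_minus_commute minus_divide_right del: minus_divide_right[symmetric])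
    finally show ?thesis by simp
  qed
  have "((\<lambda>\<epsilon>. LINT s|lborel. indicator {s. \<bar>y - s\<bar> > \<epsilon>} s *\<^sub>R g s) \<longlongrightarrow> integral\<^sup>L lborel g) (at_right 0)"
  proof (rule tendsto_integral_at_within)
    show "integrable lborel (\<lambda>s. norm (g s))" using intg by simp
    show "\<forall>\<^sub>F \<epsilon> in at_right 0. AE s in lborel. norm (indicator {s. \<bar>y - s\<bar> > \<epsilon>} s *\<^sub>R g s) \<le> norm (g s)"
      by (intro always_eventually allI AE_I2) (auto simp: indicator_def)
    show "AE s in lborel. ((\<lambda>\<epsilon>. indicator {s. \<bar>y - s\<bar> > \<epsilon>} s *\<^sub>R g s) \<longlongrightarrow> g s) (at_right 0)"
    proof (rule AE_I2, cases)
      fix s assume "s = y"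
      then have "g s = 0" by (simp add: g_def truncated_quotient_def)
      then show "((\<lambda>\<epsilon>. indicator {s. \<bar>y - s\<bar> > \<epsilon>} s *\<^sub>R g s) \<longlongrightarrow> g s) (at_right 0)" by simp
    next
      fix s assume "s \<noteq> y"
      then have "\<forall>\<^sub>F \<epsilon> in at_right 0. \<epsilon> < \<bar>y - s\<bar>"
        by (intro order_tendstoD(2)[OF tendsto_ident_at]) auto
      then have "\<forall>\<^sub>F \<epsilon> in at_right 0. indicator {s. \<bar>y - s\<bar> > \<epsilon>} s *\<^sub>R g s = g s"
        by eventually_elim simp
      then show "((\<lambda>\<epsilon>. indicator {s. \<bar>y - s\<bar> > \<epsilon>} s *\<^sub>R g s) \<longlongrightarrow> g s) (at_right 0)"
        by (rule tendsto_eventually)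
    qed
  qed measurable
  then have "((\<lambda>\<epsilon>. LINT s:{s. \<bar>y - s\<bar> > \<epsilon>}|lborel. f s / of_real (y - s)) \<longlongrightarrow> integral\<^sup>L lborel g) (at_right 0)"
    by (rule Lim_transform_eventually) (use at0 in \<open>eventually_elim, simp add: trunc del: of_real_diff\<close>)
  then show "pv_integral f y = integral\<^sup>L lborel (truncated_quotient f y \<delta>)"
    unfolding pv_integral_def g_def by (intro tendsto_Lim) auto

  \<comment> \<open>The factor is the ratio of the conjugate Poisson kernel to 1 / (y - s). It never
    exceeds 1 and tends to 1 for s different from y.\<close>
  have shrink: "norm (((y - s)\<^sup>2 / ((y - s)\<^sup>2 + \<epsilon>\<^sup>2)) *\<^sub>R g s) \<le> norm (g s)" for s \<epsilon>
  proof -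
    have "(y - s)\<^sup>2 / ((y - s)\<^sup>2 + \<epsilon>\<^sup>2) \<le> 1"
      by (cases "(y - s)\<^sup>2 + \<epsilon>\<^sup>2 = 0") (auto simp: divide_le_eq_1 less_le)
    then have "(y - s)\<^sup>2 / ((y - s)\<^sup>2 + \<epsilon>\<^sup>2) * norm (g s) \<le> norm (g s)"
      by (intro mult_left_le_one_le) auto
    then show ?thesis by simp
  qed
  have gint: "integrable lborel (\<lambda>s. ((y - s)\<^sup>2 / ((y - s)\<^sup>2 + \<epsilon>\<^sup>2)) *\<^sub>R g s)" for \<epsilon>
  proof (rule Bochner_Integration.integrable_bound[OF intg])
    show "AE s in lborel. norm (((y - s)\<^sup>2 / ((y - s)\<^sup>2 + \<epsilon>\<^sup>2)) *\<^sub>R g s) \<le> norm (g s)"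
      by (intro AE_I2) (rule shrink)
  qed measurable
  have hint: "integrable lborel (\<lambda>s. \<phi> s * ((y - s) / ((y - s)\<^sup>2 + \<epsilon>\<^sup>2)))" if "\<epsilon> > 0" for \<epsilon>
  proof (rule Bochner_Integration.integrable_bound)
    show "integrable lborel (\<lambda>s. \<delta> / \<epsilon>\<^sup>2 * \<phi> s)" using \<phi>_int by simp
    show "AE s in lborel. norm (\<phi> s * ((y - s) / ((y - s)\<^sup>2 + \<epsilon>\<^sup>2))) \<le> norm (\<delta> / \<epsilon>\<^sup>2 * \<phi> s)"
    proof (rule AE_I2)
      fix s
      show "norm (\<phi> s * ((y - s) / ((y - s)\<^sup>2 + \<epsilon>\<^sup>2))) \<le> norm (\<delta> / \<epsilon>\<^sup>2 * \<phi> s)"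
      proof (cases "s \<in> {y-\<delta><..<y+\<delta>}")
        case True
        then have \<phi>: "\<phi> s = 1" by (simp add: \<phi>_def)
        have "\<bar>y - s\<bar> < \<delta>" using True by auto
        then have "\<bar>y - s\<bar> / ((y - s)\<^sup>2 + \<epsilon>\<^sup>2) \<le> \<delta> / \<epsilon>\<^sup>2"
          using \<open>\<epsilon> > 0\<close> by (intro frac_le) auto
        moreover have "\<bar>(y - s)\<^sup>2 + \<epsilon>\<^sup>2\<bar> = (y - s)\<^sup>2 + \<epsilon>\<^sup>2" by (rule abs_of_nonneg) simp
        ultimately show ?thesis
          using \<open>0 < \<delta>\<close> unfolding \<phi> by (simp add: abs_divide)
      qed (simp add: \<phi>_def)
    qed
  qed measurable
  have reg: "f s * of_real ((y - s) / ((y - s)\<^sup>2 + \<epsilon>\<^sup>2)) =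
      ((y - s)\<^sup>2 / ((y - s)\<^sup>2 + \<epsilon>\<^sup>2)) *\<^sub>R g s + f y * of_real (\<phi> s * ((y - s) / ((y - s)\<^sup>2 + \<epsilon>\<^sup>2)))" for s \<epsilon>
  proof (cases "s = y")
    case False
    have "f s = (y - s) *\<^sub>R (f s / of_real (y - s))" using False by (simp add: scaleR_conv_of_real)
    also have "\<dots> = (y - s) *\<^sub>R g s + f y * of_real ((y - s) * (\<phi> s / (y - s)))"
      unfolding g by (simp only: scaleR_conv_of_real distrib_left of_real_mult mult_ac)
    also have "(y - s) * (\<phi> s / (y - s)) = \<phi> s" using False by simp
    finally have fs: "f s = (y - s) *\<^sub>R g s + f y * of_real (\<phi> s)" .
    have "((X::real) *\<^sub>R a + b * of_real c) * of_real (X / D) = (X\<^sup>2 / D) *\<^sub>R a + b * of_real (c * (X / D))" for X D c and a b :: complex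
      by (simp add: scaleR_conv_of_real power2_eq_square add_divide_distrib distrib_right distrib_left mult_ac)
    then show ?thesis by (subst fs)
  qed simp
  show "integrable lborel (\<lambda>s. f s * of_real ((y - s) / ((y - s)\<^sup>2 + \<epsilon>\<^sup>2)))" if "\<epsilon> > 0" for \<epsilon>
    unfolding reg using gint hint[OF that]
    by (intro Bochner_Integration.integrable_add integrable_mult_right integrable_of_real)
  have "((\<lambda>\<epsilon>. LINT s|lborel. ((y - s)\<^sup>2 / ((y - s)\<^sup>2 + \<epsilon>\<^sup>2)) *\<^sub>R g s) \<longlongrightarrow> integral\<^sup>L lborel g) (at_right 0)"
  proof (rule tendsto_integral_at_within)
    show "integrable lborel (\<lambda>s. norm (g s))" using intg by simp
    show "\<forall>\<^sub>F \<epsilon> in at_right 0. AE s in lborel. norm (((y - s)\<^sup>2 / ((y - s)\<^sup>2 + \<epsilon>\<^sup>2)) *\<^sub>R g s) \<le> norm (g s)"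
      by (intro always_eventually allI AE_I2) (rule shrink)
    show "AE s in lborel. ((\<lambda>\<epsilon>. ((y - s)\<^sup>2 / ((y - s)\<^sup>2 + \<epsilon>\<^sup>2)) *\<^sub>R g s) \<longlongrightarrow> g s) (at_right 0)"
    proof (rule AE_I2, cases)
      fix s assume "s = y"
      then have "g s = 0" by (simp add: g_def truncated_quotient_def)
      then show "((\<lambda>\<epsilon>. ((y - s)\<^sup>2 / ((y - s)\<^sup>2 + \<epsilon>\<^sup>2)) *\<^sub>R g s) \<longlongrightarrow> g s) (at_right 0)" by simp
    next
      fix s assume "s \<noteq> y"
      then have "((\<lambda>\<epsilon>. ((y - s)\<^sup>2 / ((y - s)\<^sup>2 + \<epsilon>\<^sup>2)) *\<^sub>R g s) \<longlongrightarrow> ((y - s)\<^sup>2 / ((y - s)\<^sup>2 + 0\<^sup>2)) *\<^sub>R g s) (at_right 0)"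
        by (intro tendsto_intros) auto
      then show "((\<lambda>\<epsilon>. ((y - s)\<^sup>2 / ((y - s)\<^sup>2 + \<epsilon>\<^sup>2)) *\<^sub>R g s) \<longlongrightarrow> g s) (at_right 0)"
        using \<open>s \<noteq> y\<close> by simp
    qed
  qed measurable
  then show "((\<lambda>\<epsilon>. LINT s|lborel. f s * of_real ((y - s) / ((y - s)\<^sup>2 + \<epsilon>\<^sup>2))) \<longlongrightarrow> integral\<^sup>L lborel (truncated_quotient f y \<delta>)) (at_right 0)"
    unfolding g_def[symmetric]
  proof (rule Lim_transform_eventually)
    show "\<forall>\<^sub>F \<epsilon> in at_right 0. (LINT s|lborel. ((y - s)\<^sup>2 / ((y - s)\<^sup>2 + \<epsilon>\<^sup>2)) *\<^sub>R g s) =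
        (LINT s|lborel. f s * of_real ((y - s) / ((y - s)\<^sup>2 + \<epsilon>\<^sup>2)))"
      using at0
    proof eventually_elim
      case (elim \<epsilon>)
      have "(LINT s|lborel. \<phi> s * ((y - s) / ((y - s)\<^sup>2 + \<epsilon>\<^sup>2))) = 0"
      proof (rule integral_odd_about[of _ y])
        fix s
        have "y - (2 * y - s) = - (y - s)" by simp
        then show "\<phi> (2 * y - s) * ((y - (2 * y - s)) / ((y - (2 * y - s))\<^sup>2 + \<epsilon>\<^sup>2)) =
            - (\<phi> s * ((y - s) / ((y - s)\<^sup>2 + \<epsilon>\<^sup>2)))"
          by (simp only: \<phi>_odd power2_minus minus_divide_left[symmetric] mult_minus_right)
      qed
      then have "(LINT s|lborel. f y * of_real (\<phi> s * ((y - s) / ((y - s)\<^sup>2 + \<epsilon>\<^sup>2)))) = 0"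
        by (simp only: integral_mult_right_zero integral_complex_of_real) simp
      then show ?case
        unfolding reg using gint[of \<epsilon>] hint[OF elim]
        by (subst Bochner_Integration.integral_add) (auto intro!: integrable_mult_right integrable_of_real simp del: of_real_mult of_real_divide)
    qed
  qed
qed

text \<open>This regularizes 1/(Y - s) - 1/(Y + s) = 2s / (Y^2 - s^2), the kernel of pi
  \<open>K_op\<close> on one half line. With z = Y + i \<epsilon> it is the real part of 2s / (z^2 -
  s^2).\<close>

definition reg_kernel :: "real \<Rightarrow> real \<Rightarrow> real \<Rightarrow> real" where
  "reg_kernel \<epsilon> Y s = (Y - s) / ((Y - s)\<^sup>2 + \<epsilon>\<^sup>2) - (Y + s) / ((Y + s)\<^sup>2 + \<epsilon>\<^sup>2)"

text \<open>Both the part of the Hilbert kernel away from y and the kernel 1 / (|y| + |s|) decay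
  like 1 / sqrt(1 + s^2), so one weighted integrability condition on f covers both.\<close>

lemma integrable_div_by_linear_growth:
  fixes f :: "real \<Rightarrow> complex" and d :: "real \<Rightarrow> real"
  assumes [measurable]: "f \<in> borel_measurable borel" "d \<in> borel_measurable borel" "S \<in> sets borel"
    and int: "integrable lborel (\<lambda>s. f s / of_real (sqrt (1 + s\<^sup>2)))"
    and C: "0 \<le> C" "\<And>s. s \<in> S \<Longrightarrow> 1 + s\<^sup>2 \<le> C\<^sup>2 * (d s)\<^sup>2"
  shows "integrable lborel (\<lambda>s. indicator S s *\<^sub>R (f s / of_real (d s)))"
proof (rule Bochner_Integration.integrable_bound)
  show "integrable lborel (\<lambda>s. of_real C * (f s / of_real (sqrt (1 + s\<^sup>2))))"
    using int by (rule integrable_mult_right)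
  show "AE s in lborel. norm (indicator S s *\<^sub>R (f s / of_real (d s))) \<le>
      norm (of_real C * (f s / of_real (sqrt (1 + s\<^sup>2))))"
  proof (intro AE_I2)
    fix s
    show "norm (indicator S s *\<^sub>R (f s / of_real (d s))) \<le>
      norm (of_real C * (f s / of_real (sqrt (1 + s\<^sup>2))))"
    proof (cases "s \<in> S")
      case True
      have pos: "1 + s\<^sup>2 > 0" by (simp add: add_pos_nonneg)
      have "sqrt (1 + s\<^sup>2) \<le> sqrt (C\<^sup>2 * (d s)\<^sup>2)"
        using C(2)[OF True] by simp
      then have le: "sqrt (1 + s\<^sup>2) \<le> C * \<bar>d s\<bar>"
        using C(1) by (simp add: real_sqrt_mult)
      have "d s \<noteq> 0" using C(2)[OF True] pos by auto
      have "norm (f s) * sqrt (1 + s\<^sup>2) \<le> norm (f s) * (C * \<bar>d s\<bar>)"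
        using le by (intro mult_left_mono) auto
      then show ?thesis
        using True pos \<open>d s \<noteq> 0\<close> C(1) by (simp add: norm_mult norm_divide divide_simps mult_ac)
    qed simp
  qed
qed measurable

text \<open>
  The two summands of \<open>K_op f y\<close> cancel on the half line not containing \<open>y\<close>.
\<close>

lemma K_op_eqI:
  fixes f :: "real \<Rightarrow> complex"
  assumes meas [measurable]: "f \<in> borel_measurable borel" and y: "y \<noteq> 0"
    and int: "integrable lborel (\<lambda>s. f s / of_real (sqrt (1 + s\<^sup>2)))"
    and \<delta>: "0 < \<delta>" and lip: "\<And>s. \<bar>s - y\<bar> < \<delta> \<Longrightarrow> norm (f s - f y) \<le> L * \<bar>s - y\<bar>"
    and lim: "((\<lambda>\<epsilon>. LINT s|half_line. f (sgn y * s) * of_real (reg_kernel \<epsilon> \<bar>y\<bar> s)) \<longlongrightarrow> l) (at_right 0)"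
  shows "K_op f y = l / of_real pi"
proof -
  have L: "0 \<le> L"
  proof -
    have "0 \<le> L * (\<delta> / 2)"
      using order_trans[OF norm_ge_zero lip[of "y + \<delta> / 2"]] \<delta> by simp
    then show ?thesis using \<delta> by (simp add: zero_le_mult_iff)
  qed
  have at0: "\<forall>\<^sub>F \<epsilon> in at_right 0. 0 < (\<epsilon>::real)"
    by (simp add: eventually_at_right_less)
  have quotient: "integrable lborel (truncated_quotient f y \<delta>)"
  proof -
    \<comment> \<open>Chosen so that K \<delta>^2 = 1 + 2 y^2. Outside the interval this is at most
      K (y - s)^2, and 1 + s^2 is at most 1 + 2 y^2 + 2 (y - s)^2.\<close>
    define K where "K = (1 + 2 * y\<^sup>2) / \<delta>\<^sup>2"
    have K: "K \<ge> 0" by (simp add: K_def)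
    define S where "S = - {y-\<delta><..<y+\<delta>}"
    have "integrable lborel (\<lambda>s. indicator S s *\<^sub>R (f s / of_real (y - s)))"
    proof (rule integrable_div_by_linear_growth[where C = "sqrt (K + 2)"])
      fix s assume "s \<in> S"
      then have "\<delta> \<le> \<bar>y - s\<bar>" by (auto simp: S_def)
      then have "\<delta>\<^sup>2 \<le> (y - s)\<^sup>2" using \<delta> by (metis abs_of_pos abs_le_square_iff)
      then have "K * \<delta>\<^sup>2 \<le> K * (y - s)\<^sup>2"
        by (intro mult_left_mono) (auto simp: K_def)
      moreover have "K * \<delta>\<^sup>2 = 1 + 2 * y\<^sup>2"
        using \<delta> by (simp add: K_def)
      ultimately have "1 + 2 * y\<^sup>2 + 2 * (y - s)\<^sup>2 \<le> (K + 2) * (y - s)\<^sup>2"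
        by (simp add: distrib_right)
      moreover have "1 + s\<^sup>2 \<le> 1 + 2 * y\<^sup>2 + 2 * (y - s)\<^sup>2"
        using zero_le_power2[of "s - 2 * y"] by (simp add: power2_eq_square algebra_simps)
      ultimately show "1 + s\<^sup>2 \<le> (sqrt (K + 2))\<^sup>2 * (y - s)\<^sup>2"
        using K by simp
    qed (use int K in \<open>auto simp: S_def\<close>)
    moreover have "integrable lborel (\<lambda>s. indicator {y-\<delta><..<y+\<delta>} s *\<^sub>R ((f s - f y) / of_real (y - s)))"
    proof (rule Bochner_Integration.integrable_bound)
      show "integrable lborel (\<lambda>s. indicator {y-\<delta><..<y+\<delta>} s * L)"
        using \<delta> by (intro integrable_mult_left integrable_real_indicator) auto
      show "AE s in lborel. norm (indicator {y-\<delta><..<y+\<delta>} s *\<^sub>R ((f s - f y) / of_real (y - s))) \<le>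
          norm (indicator {y-\<delta><..<y+\<delta>} s * L)"
      proof (intro AE_I2)
        fix s
        show "norm (indicator {y-\<delta><..<y+\<delta>} s *\<^sub>R ((f s - f y) / of_real (y - s))) \<le>
          norm (indicator {y-\<delta><..<y+\<delta>} s * L)"
        proof (cases "s \<in> {y-\<delta><..<y+\<delta>} \<and> s \<noteq> y")
          case True
          then have "norm (f s - f y) \<le> L * \<bar>s - y\<bar>" by (intro lip) auto
          then have "norm ((f s - f y) / of_real (y - s)) \<le> L"
            using True unfolding norm_divide norm_of_real by (simp add: divide_le_eq abs_minus_commute)
          then show ?thesis using True L by simp
        qed auto
      qed
    qed measurable
    ultimately have "integrable lborel (\<lambda>s. indicator S s *\<^sub>R (f s / of_real (y - s)) +
        indicator {y-\<delta><..<y+\<delta>} s *\<^sub>R ((f s - f y) / of_real (y - s)))"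
      by (rule Bochner_Integration.integrable_add)
    also have "(\<lambda>s. indicator S s *\<^sub>R (f s / of_real (y - s)) +
        indicator {y-\<delta><..<y+\<delta>} s *\<^sub>R ((f s - f y) / of_real (y - s))) = truncated_quotient f y \<delta>"
      by (rule ext) (simp add: truncated_quotient_def S_def indicator_def)
    finally show ?thesis .
  qed
  note pv = pv_integral_eq[OF meas \<delta> quotient] tendsto_conjugate_poisson[OF meas \<delta> quotient]
  define m where "m s = \<bar>y\<bar> + \<bar>s\<bar>" for s
  have m: "m s > 0" for s using y by (simp add: m_def)
  have [measurable]: "m \<in> borel_measurable borel" unfolding m_def by measurable
  have stieltjes: "integrable lborel (\<lambda>s. f s / of_real (m s))"
  proof -
    have "integrable lborel (\<lambda>s. indicator UNIV s *\<^sub>R (f s / of_real (m s)))"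
    proof (rule integrable_div_by_linear_growth[where C = "sqrt (1 / y\<^sup>2 + 1)"])
      fix s
      define K where "K = 1 / y\<^sup>2"
      have K: "K \<ge> 0" "K * y\<^sup>2 = 1" using y by (auto simp: K_def)
      have "y\<^sup>2 + s\<^sup>2 \<le> (m s)\<^sup>2"
        by (simp add: m_def power2_sum)
      then have "(1 / y\<^sup>2 + 1) * (y\<^sup>2 + s\<^sup>2) \<le> (1 / y\<^sup>2 + 1) * (m s)\<^sup>2"
        by (intro mult_left_mono) auto
      moreover have "(1 / y\<^sup>2 + 1) * (y\<^sup>2 + s\<^sup>2) = K * y\<^sup>2 + K * s\<^sup>2 + y\<^sup>2 + s\<^sup>2"
        unfolding K_def[symmetric] by (simp only: distrib_left distrib_right mult_1_left add.assoc)
      moreover have "0 \<le> K * s\<^sup>2" using K by simp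
      ultimately have "1 + s\<^sup>2 \<le> (1 / y\<^sup>2 + 1) * (m s)\<^sup>2"
        using K(2) zero_le_power2[of y] by linarith
      then show "1 + s\<^sup>2 \<le> (sqrt (1 / y\<^sup>2 + 1))\<^sup>2 * (m s)\<^sup>2"
        by simp
    qed (use int in auto)
    then show ?thesis by simp
  qed
  have reg_bound: "norm (f s * of_real (m s / ((m s)\<^sup>2 + \<epsilon>\<^sup>2))) \<le> norm (f s / of_real (m s))" for s \<epsilon>
  proof -
    have "m s / ((m s)\<^sup>2 + \<epsilon>\<^sup>2) \<le> m s / (m s)\<^sup>2"
      using m[of s] by (intro divide_left_mono) (auto intro!: mult_pos_pos add_pos_nonneg)
    also have "\<dots> = 1 / m s" by (simp add: power2_eq_square)
    finally have "norm (f s) * (m s / ((m s)\<^sup>2 + \<epsilon>\<^sup>2)) \<le> norm (f s) * (1 / m s)"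
      by (intro mult_left_mono) auto
    moreover have "norm (of_real (m s / ((m s)\<^sup>2 + \<epsilon>\<^sup>2)) :: complex) = m s / ((m s)\<^sup>2 + \<epsilon>\<^sup>2)"
      using m[of s] unfolding norm_of_real by (intro abs_of_nonneg divide_nonneg_nonneg) auto
    moreover have "norm (f s / of_real (m s)) = norm (f s) * (1 / m s)"
      using m[of s] by (simp add: norm_divide)
    ultimately show ?thesis
      by (simp only: norm_mult)
  qed
  have stieltjes_reg: "integrable lborel (\<lambda>s. f s * of_real (m s / ((m s)\<^sup>2 + \<epsilon>\<^sup>2)))" for \<epsilon>
    by (rule Bochner_Integration.integrable_bound[OF stieltjes _ AE_I2[OF reg_bound]]) measurable
  have stieltjes_lim: "((\<lambda>\<epsilon>. LINT s|lborel. f s * of_real (m s / ((m s)\<^sup>2 + \<epsilon>\<^sup>2))) \<longlongrightarrow>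
      (LINT s|lborel. f s / of_real (m s))) (at_right 0)"
  proof (rule tendsto_integral_at_within)
    show "integrable lborel (\<lambda>s. norm (f s / of_real (m s)))" using stieltjes by simp
    show "\<forall>\<^sub>F \<epsilon> in at_right 0. AE s in lborel. norm (f s * of_real (m s / ((m s)\<^sup>2 + \<epsilon>\<^sup>2))) \<le> norm (f s / of_real (m s))"
      by (intro always_eventually allI AE_I2 reg_bound)
    show "AE s in lborel. ((\<lambda>\<epsilon>. f s * of_real (m s / ((m s)\<^sup>2 + \<epsilon>\<^sup>2))) \<longlongrightarrow> f s / of_real (m s)) (at_right 0)"
    proof (rule AE_I2)
      fix s
      have "((\<lambda>\<epsilon>. f s * of_real (m s / ((m s)\<^sup>2 + \<epsilon>\<^sup>2))) \<longlongrightarrow> f s * of_real (m s / ((m s)\<^sup>2 + 0\<^sup>2))) (at_right 0)"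
        using m[of s] by (intro tendsto_intros) auto
      also have "f s * of_real (m s / ((m s)\<^sup>2 + 0\<^sup>2)) = f s / of_real (m s)"
        using m[of s] by (simp add: power2_eq_square)
      finally show "((\<lambda>\<epsilon>. f s * of_real (m s / ((m s)\<^sup>2 + \<epsilon>\<^sup>2))) \<longlongrightarrow> f s / of_real (m s)) (at_right 0)" .
    qed
  qed measurable
  have "((\<lambda>\<epsilon>. of_real (sgn y) * (LINT s|lborel. f s * of_real ((y - s) / ((y - s)\<^sup>2 + \<epsilon>\<^sup>2))) -
      (LINT s|lborel. f s * of_real (m s / ((m s)\<^sup>2 + \<epsilon>\<^sup>2)))) \<longlongrightarrow>
      of_real (sgn y) * pv_integral f y - (LINT s|lborel. f s / of_real (m s))) (at_right 0)"
    unfolding pv(1) by (intro tendsto_intros pv(2) stieltjes_lim)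
  moreover have "((\<lambda>\<epsilon>. of_real (sgn y) * (LINT s|lborel. f s * of_real ((y - s) / ((y - s)\<^sup>2 + \<epsilon>\<^sup>2))) -
      (LINT s|lborel. f s * of_real (m s / ((m s)\<^sup>2 + \<epsilon>\<^sup>2)))) \<longlongrightarrow> l) (at_right 0)"
  proof (rule Lim_transform_eventually[OF lim])
    show "\<forall>\<^sub>F \<epsilon> in at_right 0. (LINT s|half_line. f (sgn y * s) * of_real (reg_kernel \<epsilon> \<bar>y\<bar> s)) =
      of_real (sgn y) * (LINT s|lborel. f s * of_real ((y - s) / ((y - s)\<^sup>2 + \<epsilon>\<^sup>2))) -
      (LINT s|lborel. f s * of_real (m s / ((m s)\<^sup>2 + \<epsilon>\<^sup>2)))"
      using at0
    proof eventually_elim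
      case (elim \<epsilon>)
      \<comment> \<open>Both kernels are regularized with the same \<epsilon>, so they cancel
        exactly on the opposite half line before the limit is taken. After the reflection by sgn y
        only positive s remain.\<close>
      define W where "W s = f s * of_real (sgn y * ((y - s) / ((y - s)\<^sup>2 + \<epsilon>\<^sup>2)) - m s / ((m s)\<^sup>2 + \<epsilon>\<^sup>2))" for s
      have W: "sgn y * ((y - sgn y * s) / ((y - sgn y * s)\<^sup>2 + \<epsilon>\<^sup>2)) = (\<bar>y\<bar> - s) / ((\<bar>y\<bar> - s)\<^sup>2 + \<epsilon>\<^sup>2)" for s
      proof -
        have sg: "sgn y * sgn y = 1" using y by (simp add: sgn_if)
        have "y - sgn y * s = sgn y * (\<bar>y\<bar> - s)" using y by (auto simp: sgn_if abs_if)
        moreover have "(sgn y * (\<bar>y\<bar> - s))\<^sup>2 = (\<bar>y\<bar> - s)\<^sup>2"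
          using sg by (simp add: power_mult_distrib power2_eq_square[of "sgn y"])
        ultimately show ?thesis
          using sg by (simp only: times_divide_eq_right mult.assoc[symmetric] mult_1_left)
      qed
      have m': "m (sgn y * s) = \<bar>y\<bar> + \<bar>s\<bar>" for s
        using y by (simp add: m_def abs_mult)
      have "of_real (sgn y) * (LINT s|lborel. f s * of_real ((y - s) / ((y - s)\<^sup>2 + \<epsilon>\<^sup>2))) -
        (LINT s|lborel. f s * of_real (m s / ((m s)\<^sup>2 + \<epsilon>\<^sup>2))) =
        (LINT s|lborel. of_real (sgn y) * (f s * of_real ((y - s) / ((y - s)\<^sup>2 + \<epsilon>\<^sup>2))) -
          f s * of_real (m s / ((m s)\<^sup>2 + \<epsilon>\<^sup>2)))"
        using integrable_conjugate_poisson[OF meas \<delta> quotient elim] stieltjes_reg[of \<epsilon>]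
        by (subst Bochner_Integration.integral_diff) (auto intro!: integrable_mult_right simp only: integral_mult_right_zero)
      also have "\<dots> = (LINT s|lborel. W s)"
        by (simp only: W_def of_real_diff of_real_mult right_diff_distrib mult_ac)
      also have "\<dots> = (LINT s|half_line. W (sgn y * s))"
      proof (rule integral_half_line_reflect_eq)
        show "W (sgn y * s) = 0" if "s \<le> 0" for s
          unfolding W_def W m' using that by simp
      qed (use y in \<open>simp add: abs_sgn_eq\<close>)
      also have "\<dots> = (LINT s|half_line. f (sgn y * s) * of_real (reg_kernel \<epsilon> \<bar>y\<bar> s))"
      proof (rule Bochner_Integration.integral_cong)
        fix s assume "s \<in> space half_line"
        then have "\<bar>s\<bar> = s" by (simp add: space_restrict_space)
        then show "W (sgn y * s) = f (sgn y * s) * of_real (reg_kernel \<epsilon> \<bar>y\<bar> s)"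
          unfolding W_def W m' reg_kernel_def by simp
      qed simp
      finally show ?case ..
    qed
  qed
  ultimately have "of_real (sgn y) * pv_integral f y - (LINT s|lborel. f s / of_real (m s)) = l"
    by (rule tendsto_unique[OF trivial_limit_at_right_real])
  moreover have "K_op f y = (of_real (sgn y) * pv_integral f y - (LINT s|lborel. f s / of_real (m s))) / of_real pi"
    unfolding K_op_def m_def by (simp add: diff_divide_distrib)
  ultimately show ?thesis by simp
qed

section \<open>The regularized kernel on powers\<close>

text \<open>Partial fractions at Y + i \<epsilon> and its conjugate. Multiplying these points by -i
  and i gives \<epsilon> - iY and \<epsilon> + iY, which have positive real part and so are
  admissible parameters B.\<close>

lemma reg_kernel_eq:
  assumes "0 < \<epsilon>"
  shows "complex_of_real (reg_kernel \<epsilon> Y s) =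
    - of_real s / ((of_real s)\<^sup>2 + (Complex \<epsilon> Y)\<^sup>2) - of_real s / ((of_real s)\<^sup>2 + (Complex \<epsilon> (- Y))\<^sup>2)"
proof -
  define z where "z = complex_of_real Y + \<i> * of_real \<epsilon>"
  define s' where "s' = complex_of_real s"
  have nz: "z - s' \<noteq> 0" "z + s' \<noteq> 0" "cnj z - s' \<noteq> 0" "cnj z + s' \<noteq> 0"
    using assms by (auto simp: complex_eq_iff z_def s'_def)
  have sq: "s'\<^sup>2 + (Complex \<epsilon> Y)\<^sup>2 = - ((cnj z - s') * (cnj z + s'))"
    "s'\<^sup>2 + (Complex \<epsilon> (- Y))\<^sup>2 = - ((z - s') * (z + s'))"
    by (auto simp: complex_eq_iff z_def s'_def power2_eq_square algebra_simps)
  have half: "of_real (a / (a\<^sup>2 + \<epsilon>\<^sup>2)) = (1 / (of_real a + \<i> * of_real \<epsilon>) + 1 / (of_real a - \<i> * of_real \<epsilon>)) / 2" for a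
  proof -
    have "of_real a + \<i> * of_real \<epsilon> \<noteq> 0" "of_real a - \<i> * of_real \<epsilon> \<noteq> 0"
      using assms by (auto simp: complex_eq_iff)
    moreover have "(of_real a + \<i> * of_real \<epsilon>) * (of_real a - \<i> * of_real \<epsilon>) = of_real (a\<^sup>2 + \<epsilon>\<^sup>2)"
      by (simp add: algebra_simps power2_eq_square)
    ultimately have "1 / (of_real a + \<i> * of_real \<epsilon>) + 1 / (of_real a - \<i> * of_real \<epsilon>) =
        2 * (of_real a / of_real (a\<^sup>2 + \<epsilon>\<^sup>2))"
      by (simp add: add_frac_eq)
    then show ?thesis
      unfolding of_real_divide by (simp only: nonzero_mult_div_cancel_left[OF zero_neq_numeral[symmetric]])
  qed
  have "complex_of_real (reg_kernel \<epsilon> Y s) =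
     (1 / (z - s') + 1 / (cnj z - s')) / 2 - (1 / (z + s') + 1 / (cnj z + s')) / 2"
    unfolding reg_kernel_def of_real_diff half by (simp add: z_def s'_def algebra_simps)
  also have "\<dots> = (1 / (z - s') - 1 / (z + s')) / 2 + (1 / (cnj z - s') - 1 / (cnj z + s')) / 2"
  proof -
    have "(a + b) / 2 - (c + d) / 2 = (a - c) / 2 + (b - d) / 2" for a b c d :: complex
      by (simp add: field_simps)
    then show ?thesis .
  qed
  also have "1 / (z - s') - 1 / (z + s') = 2 * s' / ((z - s') * (z + s'))"
    using nz by (simp add: diff_frac_eq)
  also have "1 / (cnj z - s') - 1 / (cnj z + s') = 2 * s' / ((cnj z - s') * (cnj z + s'))"
    using nz by (simp add: diff_frac_eq)
  finally show ?thesis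
    unfolding sq s'_def[symmetric] by simp
qed

text \<open>The two boundary values on the imaginary axis carry opposite phases exp(-i pi \<alpha> /
  2) and exp(i pi \<alpha> / 2); their sum is the source of the cosine in the limit formula.\<close>

lemma powr_imaginary_axis_sum:
  assumes "0 < Y"
  shows "(Complex 0 Y) powr (- of_real \<alpha>) + (Complex 0 (- Y)) powr (- of_real \<alpha>) =
    of_real (2 * Y powr (- \<alpha>) * cos (pi * \<alpha> / 2))"
proof -
  have "Complex 0 Y = of_real Y * \<i>" "Complex 0 (- Y) = of_real Y * (- \<i>)"
    by (auto simp: complex_eq_iff)
  moreover have "(of_real Y * w) powr (- of_real \<alpha>) = of_real (Y powr (- \<alpha>)) * w powr (- of_real \<alpha>)" for w :: complex
    using assms powr_of_real[of Y "- \<alpha>"] by (subst powr_times_real_left) auto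
  moreover have "\<i> powr (- of_real \<alpha>) + (- \<i>) powr (- of_real \<alpha>) = 2 * cos (of_real (pi * \<alpha> / 2))"
    by (simp add: powr_def cos_exp_eq mult_ac)
  ultimately have "(Complex 0 Y) powr (- of_real \<alpha>) + (Complex 0 (- Y)) powr (- of_real \<alpha>) =
      of_real (Y powr (- \<alpha>)) * (2 * cos (of_real (pi * \<alpha> / 2)))"
    by (simp only: flip: distrib_left)
  also have "\<dots> = of_real (2 * Y powr (- \<alpha>) * cos (pi * \<alpha> / 2))"
    by (simp only: cos_of_real of_real_mult of_real_numeral mult_ac)
  finally show ?thesis .
qed

lemma powr_times_reg_kernel:
  fixes A :: complex
  assumes "0 < \<epsilon>" "0 < s"
  shows "of_real (s powr (- \<alpha>)) / ((of_real s)\<^sup>2 + A\<^sup>2) * of_real (reg_kernel \<epsilon> Y s) =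
    - (of_real (s powr (1 - \<alpha>)) / (((of_real s)\<^sup>2 + A\<^sup>2) * ((of_real s)\<^sup>2 + (Complex \<epsilon> Y)\<^sup>2)) +
       of_real (s powr (1 - \<alpha>)) / (((of_real s)\<^sup>2 + A\<^sup>2) * ((of_real s)\<^sup>2 + (Complex \<epsilon> (- Y))\<^sup>2)))"
proof -
  have "s powr (1 - \<alpha>) = s * s powr (- \<alpha>)"
    using assms(2) powr_add[of s 1 "- \<alpha>"] by simp
  then show ?thesis
    unfolding reg_kernel_eq[OF assms(1)] by (simp add: right_diff_distrib mult_ac)
qed

lemma integrable_powr_times_reg_kernel:
  fixes A :: complex
  assumes "-2 < \<alpha>" "\<alpha> < 2" "0 < Re A" "0 < \<epsilon>"
  shows "integrable half_line (\<lambda>s. of_real (s powr (- \<alpha>)) / ((of_real s)\<^sup>2 + A\<^sup>2) * of_real (reg_kernel \<epsilon> Y s))"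
proof -
  define h where "h B s = of_real (s powr (1 - \<alpha>)) / (((of_real s)\<^sup>2 + A\<^sup>2) * ((of_real s)\<^sup>2 + B\<^sup>2))" for B s
  have h: "integrable half_line (h B)" if "Re B > 0" for B
    unfolding h_def using integrable_pair_kernel[of \<alpha> A B 1] assms that by simp
  have "integrable half_line (\<lambda>s. - (h (Complex \<epsilon> Y) s + h (Complex \<epsilon> (- Y)) s))"
    using h assms(4) by (intro integrable_minus Bochner_Integration.integrable_add) auto
  also have "?this \<longleftrightarrow> ?thesis"
    using assms(4) unfolding h_def
    by (intro Bochner_Integration.integrable_cong powr_times_reg_kernel[symmetric]) (auto simp: space_restrict_space)
  finally show ?thesis .
qed

text \<open>For \<epsilon> > 0 the integral is a sum of two closed forms \<open>J\<close> at B =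
  \<epsilon> + iY and B = \<epsilon> - iY. \<open>J\<close> is continuous at the limit points: they
  avoid the branch cut because Y > 0, and B^2 - A^2 tends to -(Y^2 + A^2), which is nonzero.\<close>

lemma tendsto_integral_reg_kernel:
  fixes A :: complex
  assumes "-2 < \<alpha>" "\<alpha> < 2" "\<alpha> \<noteq> 0" "0 < Re A" "0 < Y"
  shows "((\<lambda>\<epsilon>. LINT s|half_line. of_real (s powr (- \<alpha>)) / ((of_real s)\<^sup>2 + A\<^sup>2) * of_real (reg_kernel \<epsilon> Y s)) \<longlongrightarrow>
    of_real (pi / sin (pi * \<alpha> / 2)) * (A powr (- of_real \<alpha>) - of_real (Y powr (- \<alpha>) * cos (pi * \<alpha> / 2))) /
      ((of_real Y)\<^sup>2 + A\<^sup>2)) (at_right 0)"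
proof -
  define e :: complex where "e = of_real (pi / (2 * sin (pi * \<alpha> / 2)))"
  define J where "J B = e * (A powr (- of_real \<alpha>) - B powr (- of_real \<alpha>)) / (B\<^sup>2 - A\<^sup>2)" for B
  have nz: "- (of_real Y)\<^sup>2 - A\<^sup>2 \<noteq> 0"
  proof -
    have "- (of_real Y)\<^sup>2 - A\<^sup>2 = - ((of_real Y)\<^sup>2 + A\<^sup>2)" by simp
    then show ?thesis using square_add_nonzero[OF assms(4), of Y] by (simp only: neg_equal_0_iff_equal not_False_eq_True)
  qed
  have lim: "((\<lambda>\<epsilon>. Complex \<epsilon> y) \<longlongrightarrow> Complex 0 y) (at_right 0)" for y
    by (intro tendsto_Complex tendsto_intros)
  have sq: "(Complex 0 y)\<^sup>2 = - (of_real Y)\<^sup>2" if "y = Y \<or> y = -Y" for y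
    using that by (auto simp: complex_eq_iff power2_eq_square)
  have ne: "\<forall>\<^sub>F \<epsilon> in at_right 0. A\<^sup>2 \<noteq> (Complex \<epsilon> y)\<^sup>2" if "y = Y \<or> y = -Y" for y
  proof -
    have "((\<lambda>\<epsilon>. (Complex \<epsilon> y)\<^sup>2) \<longlongrightarrow> (Complex 0 y)\<^sup>2) (at_right 0)"
      by (intro tendsto_intros lim)
    then have "\<forall>\<^sub>F \<epsilon> in at_right 0. (Complex \<epsilon> y)\<^sup>2 \<noteq> A\<^sup>2"
      by (rule tendsto_imp_eventually_ne) (use nz sq[OF that] in auto)
    then show ?thesis by eventually_elim auto
  qed
  have J: "((\<lambda>\<epsilon>. J (Complex \<epsilon> y)) \<longlongrightarrow> J (Complex 0 y)) (at_right 0)" if "y = Y \<or> y = -Y" for y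
    unfolding J_def using nz sq[OF that] assms(5) that
    by (intro tendsto_intros lim tendsto_powr_complex)
      (auto simp: complex_nonpos_Reals_iff)
  have "((\<lambda>\<epsilon>. - (J (Complex \<epsilon> Y) + J (Complex \<epsilon> (- Y)))) \<longlongrightarrow> - (J (Complex 0 Y) + J (Complex 0 (- Y)))) (at_right 0)"
    by (intro tendsto_intros J) auto
  also have "- (J (Complex 0 Y) + J (Complex 0 (- Y))) =
     e * (2 * A powr (- of_real \<alpha>) - ((Complex 0 Y) powr (- of_real \<alpha>) + (Complex 0 (- Y)) powr (- of_real \<alpha>))) / ((of_real Y)\<^sup>2 + A\<^sup>2)"
  proof -
    have "- (J (Complex 0 Y) + J (Complex 0 (- Y))) =
      - (e * (2 * A powr (- of_real \<alpha>) - ((Complex 0 Y) powr (- of_real \<alpha>) + (Complex 0 (- Y)) powr (- of_real \<alpha>))) / (- (of_real Y)\<^sup>2 - A\<^sup>2))"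
      unfolding J_def sq[OF disjI1[OF refl]] sq[OF disjI2[OF refl]]
      unfolding add_divide_distrib[symmetric] by (simp add: algebra_simps)
    also have "- (of_real Y)\<^sup>2 - A\<^sup>2 = - ((of_real Y)\<^sup>2 + A\<^sup>2)" by simp
    finally show ?thesis by (simp only: divide_minus_right minus_minus)
  qed
  also have "\<dots> = of_real (pi / sin (pi * \<alpha> / 2)) * (A powr (- of_real \<alpha>) - of_real (Y powr (- \<alpha>) * cos (pi * \<alpha> / 2))) /
      ((of_real Y)\<^sup>2 + A\<^sup>2)"
  proof -
    have "e * (2 * a - of_real (2 * b * c)) = 2 * e * (a - of_real (b * c))" for a b c
      by (simp add: algebra_simps)
    moreover have "2 * e = of_real (pi / sin (pi * \<alpha> / 2))"
      by (simp add: e_def)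
    ultimately show ?thesis
      unfolding powr_imaginary_axis_sum[OF assms(5)] by (simp only:)
  qed
  finally show ?thesis
  proof (rule Lim_transform_eventually)
    show "\<forall>\<^sub>F \<epsilon> in at_right 0. - (J (Complex \<epsilon> Y) + J (Complex \<epsilon> (- Y))) =
      (LINT s|half_line. of_real (s powr (- \<alpha>)) / ((of_real s)\<^sup>2 + A\<^sup>2) * of_real (reg_kernel \<epsilon> Y s))"
      using eventually_at_right_less[of 0] ne[OF disjI1[OF refl]] ne[OF disjI2[OF refl]]
    proof eventually_elim
      case (elim \<epsilon>)
      define h where "h B s = of_real (s powr (1 - \<alpha>)) / (((of_real s)\<^sup>2 + A\<^sup>2) * ((of_real s)\<^sup>2 + B\<^sup>2))" for B s
      have h: "integrable half_line (h B)" if "Re B > 0" for B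
        unfolding h_def using integrable_pair_kernel[of \<alpha> A B 1] assms that by simp
      have I: "(LINT s|half_line. h (Complex \<epsilon> Y) s) = J (Complex \<epsilon> Y)"
        "(LINT s|half_line. h (Complex \<epsilon> (- Y)) s) = J (Complex \<epsilon> (- Y))"
        unfolding h_def J_def e_def using assms elim by (intro integral_pair_kernel; simp)+
      have "(LINT s|half_line. of_real (s powr (- \<alpha>)) / ((of_real s)\<^sup>2 + A\<^sup>2) * of_real (reg_kernel \<epsilon> Y s)) =
          (LINT s|half_line. - (h (Complex \<epsilon> Y) s + h (Complex \<epsilon> (- Y)) s))"
      proof (rule Bochner_Integration.integral_cong)
        fix s assume "s \<in> space half_line"
        then have s: "s > 0" by (simp add: space_restrict_space)
        show "of_real (s powr (- \<alpha>)) / ((of_real s)\<^sup>2 + A\<^sup>2) * of_real (reg_kernel \<epsilon> Y s) =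
            - (h (Complex \<epsilon> Y) s + h (Complex \<epsilon> (- Y)) s)"
          unfolding h_def by (rule powr_times_reg_kernel) (use elim s in auto)
      qed simp
      also have "\<dots> = - (J (Complex \<epsilon> Y) + J (Complex \<epsilon> (- Y)))"
        using h elim(1) by (simp add: I)
      finally show ?case ..
    qed
  qed
qed

section \<open>The kernel of the solution formula\<close>

definition dirichlet_kernel :: "real \<Rightarrow> real \<Rightarrow> real \<Rightarrow> real \<Rightarrow> real" where
  "dirichlet_kernel \<alpha> x t y =
     (2 * x * t * y + \<bar>y\<bar> powr (- \<alpha>) *
        Im ((of_real \<bar>x\<bar> + \<i> * of_real t) powr of_real (\<alpha> + 1) *
            ((of_real y)\<^sup>2 - (of_real \<bar>x\<bar> - \<i> * of_real t)\<^sup>2)))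
     / ((t\<^sup>2 + (x - y)\<^sup>2) * (t\<^sup>2 + (x + y)\<^sup>2))"

text \<open>With N = s^2 + A^2 and A = t - i |x|, the denominator of the kernel is |N|^2 and y^2 -
  (|x| - it)^2 is the conjugate of N, so the kernel is an imaginary part of a quotient by N. The
  term 2xty is the imaginary part of sgn(x) y times the conjugate of N.\<close>

lemma dirichlet_kernel_half_line:
  assumes "0 < s" "\<sigma> = 1 \<or> \<sigma> = -1"
  shows "dirichlet_kernel \<alpha> x t (\<sigma> * s) =
    Im ((of_real (\<sigma> * sgn x * s) + Complex \<bar>x\<bar> t powr of_real (\<alpha> + 1) * of_real (s powr (- \<alpha>))) /
        ((of_real s)\<^sup>2 + (Complex t (- \<bar>x\<bar>))\<^sup>2))"
proof -
  define N where "N = (of_real s)\<^sup>2 + (Complex t (- \<bar>x\<bar>))\<^sup>2"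
  define w where "w = Complex \<bar>x\<bar> t powr of_real (\<alpha> + 1)"
  have z: "of_real \<bar>x\<bar> + \<i> * of_real t = Complex \<bar>x\<bar> t"
    by (auto simp: complex_eq_iff)
  have cnj: "(of_real (\<sigma> * s))\<^sup>2 - (of_real \<bar>x\<bar> - \<i> * of_real t)\<^sup>2 = cnj N"
    using assms(2) by (auto simp: N_def complex_eq_iff power2_eq_square)
  have "(norm N)\<^sup>2 = (s\<^sup>2 + t\<^sup>2 - x\<^sup>2)\<^sup>2 + 4 * t\<^sup>2 * x\<^sup>2"
    unfolding cmod_power2 by (simp add: N_def power2_eq_square algebra_simps)
  also have "\<dots> = (t\<^sup>2 + (x - \<sigma> * s)\<^sup>2) * (t\<^sup>2 + (x + \<sigma> * s)\<^sup>2)"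
    using assms(2) by (auto simp: power2_eq_square algebra_simps)
  finally have D: "(t\<^sup>2 + (x - \<sigma> * s)\<^sup>2) * (t\<^sup>2 + (x + \<sigma> * s)\<^sup>2) = (norm N)\<^sup>2" ..
  have "\<bar>\<sigma> * s\<bar> = s" using assms by auto
  moreover have "Im (of_real (\<sigma> * sgn x * s) * cnj N) = 2 * x * t * (\<sigma> * s)"
    by (cases "x = 0") (auto simp: N_def power2_eq_square sgn_if)
  ultimately have "dirichlet_kernel \<alpha> x t (\<sigma> * s) =
      Im ((of_real (\<sigma> * sgn x * s) + w * of_real (s powr (- \<alpha>))) * cnj N) / (norm N)\<^sup>2"
    unfolding dirichlet_kernel_def z cnj D w_def[symmetric]
    by (simp only: distrib_right plus_complex.simps) (simp add: algebra_simps)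
  also have "\<dots> = Im ((of_real (\<sigma> * sgn x * s) + w * of_real (s powr (- \<alpha>))) / N)"
    unfolding complex_div_cnj[of _ N] by (simp only: Im_divide_of_real flip: of_real_power)
  finally show ?thesis by (simp only: N_def w_def)
qed

text \<open>In the half-line form the denominator is at least \<kappa> (1 + s^2), and the numerator
  is at most M (s + s^(-\<alpha>)). The point y = 0 is left out because \<open>0 powr a\<close> is 0
  by convention.\<close>

lemma dirichlet_kernel_bound:
  assumes "0 < t"
  obtains C where "0 \<le> C" and "\<And>y. y \<noteq> 0 \<Longrightarrow>
    \<bar>dirichlet_kernel \<alpha> x t y\<bar> \<le> C * ((\<bar>y\<bar> + \<bar>y\<bar> powr (- \<alpha>)) / (1 + y\<^sup>2))"
proof -
  define A where "A = Complex t (- \<bar>x\<bar>)"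
  define \<kappa> where "\<kappa> = t\<^sup>2 / (1 + 2 * (norm A)\<^sup>2)"
  define M where "M = 1 + norm (Complex \<bar>x\<bar> t powr of_real (\<alpha> + 1))"
  have \<kappa>: "\<kappa> > 0" using assms by (auto simp: \<kappa>_def intro!: divide_pos_pos add_pos_nonneg)
  have M: "M \<ge> 1" by (simp add: M_def)
  show thesis
  proof (rule that[of "M / \<kappa>"])
    show "0 \<le> M / \<kappa>" using M \<kappa> by simp
    fix y :: real assume y: "y \<noteq> 0"
    define s where "s = \<bar>y\<bar>"
    have s: "s > 0" "y = sgn y * s" "s\<^sup>2 = y\<^sup>2" using y by (auto simp: s_def mult_sgn_abs)
    define u where "u = of_real (sgn y * sgn x * s) + Complex \<bar>x\<bar> t powr of_real (\<alpha> + 1) * of_real (s powr (- \<alpha>))"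
    have "dirichlet_kernel \<alpha> x t y = Im (u / ((of_real s)\<^sup>2 + A\<^sup>2))"
      using dirichlet_kernel_half_line[OF s(1), of "sgn y" \<alpha> x t] y s(2) by (auto simp: A_def u_def sgn_if)
    then have "\<bar>dirichlet_kernel \<alpha> x t y\<bar> \<le> norm u / norm ((of_real s)\<^sup>2 + A\<^sup>2)"
      using abs_Im_le_cmod[of "u / ((of_real s)\<^sup>2 + A\<^sup>2)"] by (simp only: norm_divide)
    also have "\<dots> \<le> (M * (s + s powr (- \<alpha>))) / (\<kappa> * (1 + s\<^sup>2))"
    proof (rule frac_le)
      have "norm u \<le> \<bar>sgn y * sgn x * s\<bar> + norm (Complex \<bar>x\<bar> t powr of_real (\<alpha> + 1)) * s powr (- \<alpha>)"
        unfolding u_def by (rule order_trans[OF norm_triangle_ineq]) (simp add: norm_mult abs_mult abs_sgn_eq)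
      also have "\<dots> \<le> M * s + M * s powr (- \<alpha>)"
      proof (rule add_mono)
        have "\<bar>sgn y * sgn x * s\<bar> \<le> 1 * s" using s(1) by (simp add: abs_mult abs_sgn_eq)
        also have "\<dots> \<le> M * s" using M s(1) by (intro mult_right_mono) auto
        finally show "\<bar>sgn y * sgn x * s\<bar> \<le> M * s" .
      qed (auto simp: M_def intro!: mult_right_mono)
      finally show "norm u \<le> M * (s + s powr (- \<alpha>))" by (simp add: distrib_left)
      show "\<kappa> * (1 + s\<^sup>2) \<le> norm ((of_real s)\<^sup>2 + A\<^sup>2)"
        unfolding \<kappa>_def by (rule norm_square_add_lower_bound) (use assms in \<open>auto simp: A_def\<close>)
      show "0 < \<kappa> * (1 + s\<^sup>2)" using \<kappa> by (intro mult_pos_pos add_pos_nonneg) auto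
      show "0 \<le> M * (s + s powr (- \<alpha>))" using M s(1) by simp
    qed
    also have "\<dots> = M / \<kappa> * ((\<bar>y\<bar> + \<bar>y\<bar> powr (- \<alpha>)) / (1 + y\<^sup>2))"
      unfolding s(3) by (simp add: s_def)
    finally show "\<bar>dirichlet_kernel \<alpha> x t y\<bar> \<le> M / \<kappa> * ((\<bar>y\<bar> + \<bar>y\<bar> powr (- \<alpha>)) / (1 + y\<^sup>2))" .
  qed
qed

section \<open>Integrability and local regularity of the kernel\<close>

lemma measurable_dirichlet_kernel [measurable]: "dirichlet_kernel \<alpha> x t \<in> borel_measurable borel"
  unfolding dirichlet_kernel_def by measurable

lemma integrable_abs_powr_rational:
  fixes a b :: real
  assumes "a > -1" "2 * b > a + 1"
  shows "integrable lborel (\<lambda>s. \<bar>s\<bar> powr a * (1 + s\<^sup>2) powr (-b))"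
proof -
  define h where "h s = indicator {0<..} s *\<^sub>R (s powr a * (1 + s\<^sup>2) powr (-b))" for s :: real
  have h: "integrable lborel h"
    using integrable_powr_rational[OF assms] unfolding integrable_half_line_iff set_integrable_def h_def .
  have "integrable lborel (\<lambda>s. h s + h (0 + (-1) * s))"
    by (intro Bochner_Integration.integrable_add h lborel_integrable_real_affine) auto
  also have "(\<lambda>s. h s + h (0 + (-1) * s)) = (\<lambda>s. \<bar>s\<bar> powr a * (1 + s\<^sup>2) powr (-b))"
    by (rule ext) (auto simp: h_def indicator_def abs_if)
  finally show ?thesis .
qed

lemma integrable_rational_boundI:
  fixes F :: "real \<Rightarrow> 'a::{banach, second_countable_topology}"
  assumes "F \<in> borel_measurable borel" "a > -1" "2 * b > a + 1" "a' > -1" "2 * b > a' + 1"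
    and bound: "\<And>s. s \<noteq> 0 \<Longrightarrow> norm (F s) \<le> C * ((\<bar>s\<bar> powr a + \<bar>s\<bar> powr a') * (1 + s\<^sup>2) powr (-b))"
  shows "integrable lborel F"
proof (rule Bochner_Integration.integrable_bound)
  show "integrable lborel (\<lambda>s. C * ((\<bar>s\<bar> powr a + \<bar>s\<bar> powr a') * (1 + s\<^sup>2) powr (-b)))"
    unfolding distrib_right using assms(2-5)
    by (intro integrable_mult_right Bochner_Integration.integrable_add integrable_abs_powr_rational)
  show "AE s in lborel. norm (F s) \<le> norm (C * ((\<bar>s\<bar> powr a + \<bar>s\<bar> powr a') * (1 + s\<^sup>2) powr (-b)))"
    using AE_lborel_singleton[of "0::real"]
    by eventually_elim (use bound in \<open>auto intro: order_trans[OF _ abs_ge_self]\<close>)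
qed (use assms(1) in simp)

text \<open>In the pointwise bound, |y|^(-\<alpha>) / (1 + y^2) has an integrable q-th power near 0
  when \<alpha> q < 1 and at infinity when (\<alpha> + 2) q > 1, which is the assumed interval. The
  summand |y| / (1 + y^2) requires q > 1.\<close>

lemma dirichlet_kernel_in_Lp:
  assumes "0 < t" "1 < q" "1 / q - 2 < \<alpha>" "\<alpha> < 1 / q"
  shows "(\<lambda>y. of_real (dirichlet_kernel \<alpha> x t y)) \<in> Lp q"
proof -
  obtain C where C: "0 \<le> C" "\<And>y. y \<noteq> 0 \<Longrightarrow>
    \<bar>dirichlet_kernel \<alpha> x t y\<bar> \<le> C * ((\<bar>y\<bar> + \<bar>y\<bar> powr (- \<alpha>)) / (1 + y\<^sup>2))"
    by (rule dirichlet_kernel_bound[OF assms(1), where \<alpha> = \<alpha> and x = x], rule that)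
  have \<alpha>: "\<alpha> * q < 1" "1 < (\<alpha> + 2) * q"
    using assms by (auto simp: field_simps)
  have "integrable lborel (\<lambda>y. norm (complex_of_real (dirichlet_kernel \<alpha> x t y)) powr q)"
  proof (rule integrable_rational_boundI[where a = q and a' = "- \<alpha> * q" and b = q and C = "(2 * C) powr q"])
    fix y :: real assume y: "y \<noteq> 0"
    have pos: "1 + y\<^sup>2 > 0" by (simp add: add_pos_nonneg)
    define u where "u = \<bar>y\<bar>"
    define v where "v = \<bar>y\<bar> powr (- \<alpha>)"
    have uv: "u \<ge> 0" "v \<ge> 0" by (auto simp: u_def v_def)
    have "\<bar>dirichlet_kernel \<alpha> x t y\<bar> \<le> C * ((u + v) / (1 + y\<^sup>2))"
      unfolding u_def v_def by (rule C(2)[OF y])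
    \<comment> \<open>The maximum lets the power q be split: max(u, v)^q is at most u^q +
      v^q.\<close>
    also have "\<dots> \<le> C * (2 * max u v / (1 + y\<^sup>2))"
      using C(1) pos by (intro mult_left_mono divide_right_mono) auto
    also have "\<dots> = 2 * C * (max u v / (1 + y\<^sup>2))" by simp
    finally have "\<bar>dirichlet_kernel \<alpha> x t y\<bar> powr q \<le> (2 * C * (max u v / (1 + y\<^sup>2))) powr q"
      using assms(2) by (intro powr_mono2) auto
    also have "\<dots> = (2 * C) powr q * (max u v powr q * (1 + y\<^sup>2) powr (- q))"
      using C(1) uv pos by (simp add: powr_mult powr_divide powr_minus_divide)
    also have "\<dots> \<le> (2 * C) powr q * ((u powr q + v powr q) * (1 + y\<^sup>2) powr (- q))"
      by (intro mult_left_mono mult_right_mono) (auto simp: max_def)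
    finally show "norm (norm (complex_of_real (dirichlet_kernel \<alpha> x t y)) powr q) \<le>
        (2 * C) powr q * ((\<bar>y\<bar> powr q + \<bar>y\<bar> powr (- \<alpha> * q)) * (1 + y\<^sup>2) powr (- q))"
      by (simp add: u_def v_def powr_powr)
  qed (use assms(2) \<alpha> in \<open>auto simp: algebra_simps\<close>)
  then show ?thesis by (simp add: Lp_def)
qed

text \<open>This is the weighted integrability demanded by \<open>K_op_eqI\<close>. The weight adds
  one order of decay, so -2 < \<alpha> suffices at infinity and \<alpha> < 1 at 0.\<close>

lemma integrable_dirichlet_kernel_div_sqrt:
  assumes "0 < t" "-2 < \<alpha>" "\<alpha> < 1"
  shows "integrable lborel (\<lambda>y. complex_of_real (dirichlet_kernel \<alpha> x t y) / of_real (sqrt (1 + y\<^sup>2)))"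
proof -
  obtain C where C: "0 \<le> C" "\<And>y. y \<noteq> 0 \<Longrightarrow>
    \<bar>dirichlet_kernel \<alpha> x t y\<bar> \<le> C * ((\<bar>y\<bar> + \<bar>y\<bar> powr (- \<alpha>)) / (1 + y\<^sup>2))"
    by (rule dirichlet_kernel_bound[OF assms(1), where \<alpha> = \<alpha> and x = x], rule that)
  show ?thesis
  proof (rule integrable_rational_boundI[where a = 1 and a' = "- \<alpha>" and b = "1 + 1 / 2" and C = C])
    fix y :: real assume y: "y \<noteq> 0"
    have pos: "1 + y\<^sup>2 > 0" by (simp add: add_pos_nonneg)
    have "(1 + y\<^sup>2) powr (- (1 + 1 / 2)) = 1 / ((1 + y\<^sup>2) powr (1 + 1 / 2))"
      by (rule powr_minus_divide)
    also have "(1 + y\<^sup>2) powr (1 + 1 / 2) = (1 + y\<^sup>2) * sqrt (1 + y\<^sup>2)"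
      using pos by (simp only: powr_add powr_half_sqrt[OF less_imp_le]) simp
    finally have eq: "(1 + y\<^sup>2) powr (- (1 + 1 / 2)) = 1 / ((1 + y\<^sup>2) * sqrt (1 + y\<^sup>2))" .
    have "norm (complex_of_real (dirichlet_kernel \<alpha> x t y) / of_real (sqrt (1 + y\<^sup>2))) =
        \<bar>dirichlet_kernel \<alpha> x t y\<bar> / sqrt (1 + y\<^sup>2)"
      unfolding norm_divide norm_of_real using pos by simp
    also have "\<dots> \<le> C * ((\<bar>y\<bar> + \<bar>y\<bar> powr (- \<alpha>)) / (1 + y\<^sup>2)) / sqrt (1 + y\<^sup>2)"
      using C(2)[OF y] pos by (intro divide_right_mono) auto
    also have "\<dots> = C * ((\<bar>y\<bar> powr 1 + \<bar>y\<bar> powr (- \<alpha>)) * (1 + y\<^sup>2) powr (- (1 + 1 / 2)))"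
      unfolding eq by simp
    finally show "norm (complex_of_real (dirichlet_kernel \<alpha> x t y) / of_real (sqrt (1 + y\<^sup>2))) \<le>
        C * ((\<bar>y\<bar> powr 1 + \<bar>y\<bar> powr (- \<alpha>)) * (1 + y\<^sup>2) powr (- (1 + 1 / 2)))" .
  qed (use assms in \<open>auto\<close>)
qed

text \<open>The kernel is differentiable away from y = 0, and near y the difference quotient differs
  from the derivative D by less than 1, so L = |D| + 1 works.\<close>

lemma dirichlet_kernel_lipschitz:
  assumes "0 < t" "y \<noteq> 0"
  obtains \<delta> L where "0 < \<delta>" and "\<And>s. \<bar>s - y\<bar> < \<delta> \<Longrightarrow>
    \<bar>dirichlet_kernel \<alpha> x t s - dirichlet_kernel \<alpha> x t y\<bar> \<le> L * \<bar>s - y\<bar>"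
proof -
  \<comment> \<open>Written as a power of s^2, the factor can be differentiated by the chain rule on
    both half lines without a case distinction on the sign.\<close>
  have abs_powr: "\<bar>s\<bar> powr (- \<alpha>) = (s\<^sup>2) powr (- \<alpha> / 2)" for s :: real
  proof -
    have "\<bar>s\<bar> powr 2 = s\<^sup>2" by (cases "s = 0") auto
    moreover have "(\<bar>s\<bar> powr 2) powr (- \<alpha> / 2) = \<bar>s\<bar> powr (- \<alpha>)" by (simp only: powr_powr) simp
    ultimately show ?thesis by metis
  qed
  have "Im (w * ((of_real s)\<^sup>2 - (of_real X - \<i> * of_real t)\<^sup>2)) =
      Im w * (s\<^sup>2 - X\<^sup>2 + t\<^sup>2) + Re w * (2 * X * t)" for w s X
    by (simp add: power2_eq_square algebra_simps)
  note Im_eq = this[of _ _ "\<bar>x\<bar>"]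
  have z: "of_real \<bar>x\<bar> + \<i> * of_real t = Complex \<bar>x\<bar> t"
    by (auto simp: complex_eq_iff)
  have "\<exists>D. (dirichlet_kernel \<alpha> x t has_real_derivative D) (at y)"
  proof -
    have nz: "(t\<^sup>2 + (x - y)\<^sup>2) * (t\<^sup>2 + (x + y)\<^sup>2) \<noteq> 0"
      using assms(1) by (simp add: add_nonneg_eq_0_iff)
    have "((\<lambda>s. s\<^sup>2) has_real_derivative 2 * y) (at y)"
      by (auto intro!: derivative_eq_intros)
    from DERIV_fun_powr[OF this, of "- \<alpha> / 2"]
    have g: "(\<lambda>s. (s\<^sup>2) powr (- \<alpha> / 2)) differentiable (at y)"
      using assms(2) unfolding real_differentiable_def by auto
    have "dirichlet_kernel \<alpha> x t differentiable (at y)"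
      unfolding dirichlet_kernel_def[abs_def] abs_powr z Im_eq
      by (intro differentiable_divide differentiable_add differentiable_mult differentiable_diff
        differentiable_power differentiable_const differentiable_ident g nz)
    then show ?thesis by (simp add: real_differentiable_def)
  qed
  then obtain D where "(dirichlet_kernel \<alpha> x t has_real_derivative D) (at y)" ..
  then have "((\<lambda>s. (dirichlet_kernel \<alpha> x t s - dirichlet_kernel \<alpha> x t y) / (s - y)) \<longlongrightarrow> D) (at y)"
    unfolding has_field_derivative_iff .
  then have "\<forall>\<^sub>F s in at y. dist ((dirichlet_kernel \<alpha> x t s - dirichlet_kernel \<alpha> x t y) / (s - y)) D < 1"
    by (rule tendstoD) simp
  then obtain \<delta> where \<delta>: "0 < \<delta>" "\<And>s. s \<noteq> y \<Longrightarrow> dist s y < \<delta> \<Longrightarrow>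
      dist ((dirichlet_kernel \<alpha> x t s - dirichlet_kernel \<alpha> x t y) / (s - y)) D < 1"
    unfolding eventually_at by auto
  show thesis
  proof (rule that[OF \<delta>(1), of "\<bar>D\<bar> + 1"])
    fix s assume s: "\<bar>s - y\<bar> < \<delta>"
    show "\<bar>dirichlet_kernel \<alpha> x t s - dirichlet_kernel \<alpha> x t y\<bar> \<le> (\<bar>D\<bar> + 1) * \<bar>s - y\<bar>"
    proof (cases "s = y")
      case False
      then have "\<bar>(dirichlet_kernel \<alpha> x t s - dirichlet_kernel \<alpha> x t y) / (s - y)\<bar> \<le> \<bar>D\<bar> + 1"
        using \<delta>(2)[of s] s unfolding dist_real_def by linarith
      then show ?thesis using False by (simp add: abs_divide divide_le_eq)
    qed simp
  qed
qed

section \<open>The boundary equation for the kernel\<close>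

lemma exp_half_angle_div_cos:
  fixes k :: real
  assumes "cos \<theta> \<noteq> 0" "tan \<theta> = k"
  shows "exp (\<i> * of_real \<theta>) / of_real (cos \<theta>) = 1 + \<i> * of_real k"
proof -
  have "sin \<theta> = k * cos \<theta>" using assms by (auto simp: tan_def)
  then have "exp (\<i> * of_real \<theta>) = of_real (cos \<theta>) * (1 + \<i> * of_real k)"
    by (simp add: cis_conv_exp[symmetric] complex_eq_iff)
  then show ?thesis using assms(1) by simp
qed

text \<open>The first base is i times A = t - iX. As |arg A| < pi/2, the principal logarithm
  satisfies Ln(iA) = i pi/2 + Ln A with no jump by 2 pi i, so the powers of A combine and the phase
  exp(i pi \<alpha> / 2) remains.\<close>

lemma powr_Suc_times_rotated_powr:
  assumes "0 < t"
  shows "Complex X t powr of_real (\<alpha> + 1) * Complex t (- X) powr (- of_real \<alpha>) =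
    exp (\<i> * of_real (pi * \<alpha> / 2)) * Complex X t"
proof -
  define A where "A = Complex t (- X)"
  have A: "Re A > 0" "A \<noteq> 0" using assms by (auto simp: A_def complex_eq_iff)
  have z: "Complex X t = \<i> * A" by (simp add: A_def complex_eq_iff)
  have "\<bar>Im (Ln A)\<bar> < pi / 2" using A Re_Ln_pos_lt by blast
  then have "Ln (\<i> * A) = \<i> * of_real (pi / 2) + Ln A"
    using A(2) by (subst Ln_times_simple) (auto simp: field_simps)
  then have "(\<i> * A) powr of_real (\<alpha> + 1) * A powr (- of_real \<alpha>) =
      exp (of_real (\<alpha> + 1) * (\<i> * of_real (pi / 2) + Ln A)) * exp ((- of_real \<alpha>) * Ln A)"
    using A(2) by (simp add: powr_def)
  also have "\<dots> = exp (of_real (\<alpha> + 1) * (\<i> * of_real (pi / 2) + Ln A) + (- of_real \<alpha>) * Ln A)"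
    by (simp only: exp_add)
  also have "of_real (\<alpha> + 1) * (\<i> * of_real (pi / 2) + Ln A) + (- of_real \<alpha>) * Ln A =
      \<i> * of_real (pi * \<alpha> / 2) + (\<i> * of_real (pi / 2) + Ln A)"
    by (simp add: algebra_simps add_divide_distrib)
  also have "exp \<dots> = exp (\<i> * of_real (pi * \<alpha> / 2)) * (\<i> * A)"
    using A(2) \<open>Ln (\<i> * A) = _\<close>[symmetric] by (simp only: exp_add[of "\<i> * of_real (pi * \<alpha> / 2)"] exp_Ln[of "\<i> * A"]) simp
  finally show ?thesis by (simp only: z A_def[symmetric])
qed

definition layer_kernel :: "real \<Rightarrow> real \<Rightarrow> real \<Rightarrow> real \<Rightarrow> real" where
  "layer_kernel k x t y = (t - (x - y) * k * sgn y) / (t\<^sup>2 + (x - y)\<^sup>2)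
     - k * ((\<bar>x\<bar> + \<bar>y\<bar>) / (t\<^sup>2 + (\<bar>x\<bar> + \<bar>y\<bar>)\<^sup>2))"

text \<open>Brings the layer kernel over the same denominator s^2 + A^2 as the half-line form of
  \<open>dirichlet_kernel\<close>, so that the boundary equation becomes an identity of
  numerators.\<close>

lemma layer_kernel_eq:
  assumes "0 < t" "0 < s" "\<sigma> = 1 \<or> \<sigma> = -1"
  shows "layer_kernel k x t (\<sigma> * s) =
    Im ((of_real (\<sigma> * sgn x) * (of_real s - of_real k * Complex t (- \<bar>x\<bar>)) + (1 + \<i> * of_real k) * Complex \<bar>x\<bar> t) /
      ((of_real s)\<^sup>2 + (Complex t (- \<bar>x\<bar>))\<^sup>2))"
proof -
  define X where "X = \<bar>x\<bar>"
  define \<tau> where "\<tau> = \<sigma> * sgn x"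
  define N where "N = (of_real s)\<^sup>2 + (Complex t (- X))\<^sup>2"
  define P where "P = t\<^sup>2 + (X - s)\<^sup>2"
  define Q where "Q = t\<^sup>2 + (X + s)\<^sup>2"
  have pos: "P > 0" "Q > 0" using assms(1) by (auto simp: P_def Q_def intro!: add_pos_nonneg)
  have "(norm N)\<^sup>2 = P * Q"
    unfolding cmod_power2 by (simp add: N_def P_def Q_def power2_eq_square algebra_simps)
  define W where "W = of_real \<tau> * (of_real s - of_real k * Complex t (- X)) + (1 + \<i> * of_real k) * Complex X t"
  have "Im (W / N) = Im (W * cnj N) / (P * Q)"
    unfolding complex_div_cnj[of _ N] \<open>(norm N)\<^sup>2 = P * Q\<close>[symmetric]
    by (simp only: Im_divide_of_real flip: of_real_power)
  moreover have "layer_kernel k x t (\<sigma> * s) = Im (W * cnj N) / (P * Q)"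
  proof -
    have sg: "sgn (\<sigma> * s) = \<sigma>" "\<bar>\<sigma> * s\<bar> = s" using assms(2,3) by (auto simp: sgn_mult)
    \<comment> \<open>\<tau> tells whether x and y lie on the same side of 0. In the cases -1 and 0
      the two k-terms cancel and only the Poisson term t / (t^2 + (x - y)^2) survives.\<close>
    consider "\<tau> = 1" "x = \<sigma> * X" | "\<tau> = -1" "x = - \<sigma> * X" | "\<tau> = 0" "x = 0" "X = 0"
    proof -
      have "\<tau> = 1 \<and> x = \<sigma> * X \<or> \<tau> = -1 \<and> x = - \<sigma> * X \<or> \<tau> = 0 \<and> x = 0 \<and> X = 0"
        by (rule disjE[OF assms(3)]; cases x "0::real" rule: linorder_cases; simp add: \<tau>_def X_def)
      then show thesis using that by blast
    qed
    then show ?thesis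
    proof cases
      case 1
      have e: "(x - \<sigma> * s) * k * \<sigma> = (X - s) * k" "(x - \<sigma> * s)\<^sup>2 = (X - s)\<^sup>2"
        using 1 assms(3) by (auto simp: power2_eq_square algebra_simps)
      have "layer_kernel k x t (\<sigma> * s) = (t - (X - s) * k) / P - k * ((X + s) / Q)"
        unfolding layer_kernel_def sg e P_def Q_def by (simp add: X_def)
      also have "\<dots> = ((t - (X - s) * k) * Q - k * (X + s) * P) / (P * Q)"
        using pos by (simp add: field_simps)
      also have "(t - (X - s) * k) * Q - k * (X + s) * P = Im (W * cnj N)"
        unfolding W_def N_def P_def Q_def 1 by (simp add: power2_eq_square algebra_simps)
      finally show ?thesis .
    next
      case 2
      have e: "(x - \<sigma> * s) * k * \<sigma> = - (X + s) * k" "(x - \<sigma> * s)\<^sup>2 = (X + s)\<^sup>2"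
        using 2 assms(3) by (auto simp: power2_eq_square algebra_simps)
      have "layer_kernel k x t (\<sigma> * s) = (t - (- (X + s) * k)) / Q - k * ((X + s) / Q)"
        unfolding layer_kernel_def sg e P_def Q_def by (simp add: X_def)
      also have "\<dots> = (t * P) / (P * Q)"
        using pos by (simp add: field_simps)
      also have "t * P = Im (W * cnj N)"
        unfolding W_def N_def P_def Q_def 2 by (simp add: power2_eq_square algebra_simps)
      finally show ?thesis .
    next
      case 3
      have PQ: "P = t\<^sup>2 + s\<^sup>2" "Q = t\<^sup>2 + s\<^sup>2" by (simp_all add: P_def Q_def 3)
      have e: "(x - \<sigma> * s) * k * \<sigma> = - s * k" "(x - \<sigma> * s)\<^sup>2 = s\<^sup>2"
        using 3 assms(3) by (auto simp: power2_eq_square algebra_simps)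
      have "layer_kernel k x t (\<sigma> * s) = (t - (- s * k)) / P - k * (s / P)"
        unfolding layer_kernel_def sg e PQ by (simp add: 3)
      also have "\<dots> = (t * Q) / (P * Q)"
        using pos by (simp add: field_simps)
      also have "t * Q = Im (W * cnj N)"
        unfolding W_def N_def PQ 3 by (simp add: power2_eq_square algebra_simps)
      finally show ?thesis .
    qed
  qed
  ultimately show ?thesis
    by (simp only: W_def N_def X_def \<tau>_def)
qed

text \<open>The limit formula is used for the exponents -1 and \<alpha>, one for each summand of the
  half-line form. The regularized kernel is real, so taking imaginary parts commutes with the
  integral and with the limit.\<close>

lemma tendsto_integral_dirichlet_kernel:
  fixes x :: real
  assumes "0 < t" "-2 < \<alpha>" "\<alpha> < 2" "\<alpha> \<noteq> 0" "0 < Y" "\<sigma> = 1 \<or> \<sigma> = -1"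
  defines "A \<equiv> Complex t (- \<bar>x\<bar>)" and "w \<equiv> Complex \<bar>x\<bar> t powr of_real (\<alpha> + 1)"
  shows "((\<lambda>\<epsilon>. LINT s|half_line. of_real (dirichlet_kernel \<alpha> x t (\<sigma> * s)) * of_real (reg_kernel \<epsilon> Y s)) \<longlongrightarrow>
    complex_of_real (Im ((of_real (\<sigma> * sgn x) * (- of_real pi * A) +
      w * (of_real (pi / sin (pi * \<alpha> / 2)) * (A powr (- of_real \<alpha>) - of_real (Y powr (- \<alpha>) * cos (pi * \<alpha> / 2))))) /
      ((of_real Y)\<^sup>2 + A\<^sup>2)))) (at_right 0)"
proof -
  have A: "Re A > 0" using assms(1) by (simp add: A_def)
  define H where "H \<beta> \<epsilon> s = of_real (s powr (- \<beta>)) / ((of_real s)\<^sup>2 + A\<^sup>2) * of_real (reg_kernel \<epsilon> Y s)" for \<beta> \<epsilon> s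
  have "((\<lambda>\<epsilon>. LINT s|half_line. H (-1) \<epsilon> s) \<longlongrightarrow>
      of_real (pi / sin (pi * (- 1) / 2)) * (A powr (- of_real (- 1)) - of_real (Y powr (- (- 1)) * cos (pi * (- 1) / 2))) /
      ((of_real Y)\<^sup>2 + A\<^sup>2)) (at_right 0)"
    unfolding H_def by (rule tendsto_integral_reg_kernel) (use A assms(5) in auto)
  \<comment> \<open>For exponent -1 the sine is -1 and the cosine vanishes, so no power of Y is
    left.\<close>
  also have "of_real (pi / sin (pi * (- 1) / 2)) * (A powr (- of_real (- 1)) - of_real (Y powr (- (- 1)) * cos (pi * (- 1) / 2))) =
      - of_real pi * A"
    using A by auto
  finally have lim1: "((\<lambda>\<epsilon>. LINT s|half_line. H (-1) \<epsilon> s) \<longlongrightarrow> - of_real pi * A / ((of_real Y)\<^sup>2 + A\<^sup>2)) (at_right 0)" .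
  have lim2: "((\<lambda>\<epsilon>. LINT s|half_line. H \<alpha> \<epsilon> s) \<longlongrightarrow>
      of_real (pi / sin (pi * \<alpha> / 2)) * (A powr (- of_real \<alpha>) - of_real (Y powr (- \<alpha>) * cos (pi * \<alpha> / 2))) /
      ((of_real Y)\<^sup>2 + A\<^sup>2)) (at_right 0)"
    unfolding H_def by (rule tendsto_integral_reg_kernel) (use A assms in auto)
  have "((\<lambda>\<epsilon>. complex_of_real (Im (of_real (\<sigma> * sgn x) * (LINT s|half_line. H (-1) \<epsilon> s) + w * (LINT s|half_line. H \<alpha> \<epsilon> s)))) \<longlongrightarrow>
     complex_of_real (Im (of_real (\<sigma> * sgn x) * (- of_real pi * A / ((of_real Y)\<^sup>2 + A\<^sup>2)) +
       w * (of_real (pi / sin (pi * \<alpha> / 2)) * (A powr (- of_real \<alpha>) - of_real (Y powr (- \<alpha>) * cos (pi * \<alpha> / 2))) /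
      ((of_real Y)\<^sup>2 + A\<^sup>2))))) (at_right 0)"
    by (intro tendsto_intros lim1 lim2)
  then show ?thesis
    unfolding times_divide_eq_right add_divide_distrib[symmetric]
  proof (rule Lim_transform_eventually)
    show "\<forall>\<^sub>F \<epsilon> in at_right 0.
      complex_of_real (Im (of_real (\<sigma> * sgn x) * (LINT s|half_line. H (-1) \<epsilon> s) + w * (LINT s|half_line. H \<alpha> \<epsilon> s))) =
      (LINT s|half_line. of_real (dirichlet_kernel \<alpha> x t (\<sigma> * s)) * of_real (reg_kernel \<epsilon> Y s))"
      using eventually_at_right_less[of 0]
    proof eventually_elim
      case (elim \<epsilon>)
      have H: "integrable half_line (H (-1) \<epsilon>)" "integrable half_line (H \<alpha> \<epsilon>)"
        unfolding H_def using A assms(2,3) elim by (intro integrable_powr_times_reg_kernel; simp)+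
      define F where "F s = of_real (\<sigma> * sgn x) * H (-1) \<epsilon> s + w * H \<alpha> \<epsilon> s" for s
      have F: "integrable half_line F"
        unfolding F_def using H by (intro Bochner_Integration.integrable_add integrable_mult_right)
      have "(LINT s|half_line. of_real (dirichlet_kernel \<alpha> x t (\<sigma> * s)) * of_real (reg_kernel \<epsilon> Y s)) =
         (LINT s|half_line. complex_of_real (Im (F s)))"
      proof (rule Bochner_Integration.integral_cong)
        fix s assume "s \<in> space half_line"
        then have s: "s > 0" by (simp add: space_restrict_space)
        have "F s = (of_real (\<sigma> * sgn x * s) + w * of_real (s powr (- \<alpha>))) / ((of_real s)\<^sup>2 + A\<^sup>2) * of_real (reg_kernel \<epsilon> Y s)"
          using s by (simp add: F_def H_def distrib_left distrib_right add_divide_distrib mult_ac)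
        then have "Im (F s) = dirichlet_kernel \<alpha> x t (\<sigma> * s) * reg_kernel \<epsilon> Y s"
          unfolding dirichlet_kernel_half_line[OF s assms(6)] A_def w_def
          by (simp only: times_complex.simps Re_complex_of_real Im_complex_of_real mult_zero_right add_0_left)
        then show "complex_of_real (dirichlet_kernel \<alpha> x t (\<sigma> * s)) * of_real (reg_kernel \<epsilon> Y s) = complex_of_real (Im (F s))"
          by simp
      qed simp
      also have "\<dots> = complex_of_real (Im (LINT s|half_line. F s))"
        using F by simp
      also have "(LINT s|half_line. F s) = of_real (\<sigma> * sgn x) * (LINT s|half_line. H (-1) \<epsilon> s) + w * (LINT s|half_line. H \<alpha> \<epsilon> s)"
        unfolding F_def using H by (simp add: integral_mult_right_zero)
      finally show ?case ..
    qed
  qed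
qed

lemma I_plus_kK_dirichlet_kernel:
  assumes "0 < t" "-2 < \<alpha>" "\<alpha> < 1" "\<alpha> \<noteq> -1" "tan (pi * \<alpha> / 2) = k" "y \<noteq> 0"
  shows "I_plus_kK k (\<lambda>s. of_real (dirichlet_kernel \<alpha> x t s)) y = of_real (layer_kernel k x t y)"
proof -
  define Y where "Y = \<bar>y\<bar>"
  define \<sigma> where "\<sigma> = sgn y"
  have Y: "Y > 0" "\<sigma> = 1 \<or> \<sigma> = -1" "y = \<sigma> * Y"
    using assms(6) by (auto simp: Y_def \<sigma>_def sgn_if)
  define A where "A = Complex t (- \<bar>x\<bar>)"
  define z where "z = Complex \<bar>x\<bar> t"
  define w where "w = z powr of_real (\<alpha> + 1)"
  define N where "N = (of_real Y)\<^sup>2 + A\<^sup>2"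
  define \<tau> where "\<tau> = \<sigma> * sgn x"
  have kernel: "dirichlet_kernel \<alpha> x t y = Im ((of_real \<tau> * of_real Y + w * of_real (Y powr (- \<alpha>))) / N)"
    using dirichlet_kernel_half_line[OF Y(1,2), of \<alpha> x t] by (simp add: Y(3) \<tau>_def w_def z_def N_def A_def)
  have layer: "layer_kernel k x t y = Im ((of_real \<tau> * (of_real Y - of_real k * A) + (1 + \<i> * of_real k) * z) / N)"
    using layer_kernel_eq[OF assms(1) Y(1,2), of k x] by (simp only: Y(3) \<tau>_def z_def N_def A_def)
  show ?thesis
  \<comment> \<open>For \<alpha> = 0 the limit formula would divide by sin 0. In this case k = 0,
    the operator is the identity, and the two kernels coincide.\<close>
  proof (cases "\<alpha> = 0")
    case True
    then have "k = 0" using assms(5) by simp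
    have "w = z" using True assms(1) by (auto simp: w_def z_def complex_eq_iff)
    then show ?thesis
      unfolding I_plus_kK_def kernel layer using \<open>k = 0\<close> True Y(1) by simp
  next
    case False
    define S where "S = sin (pi * \<alpha> / 2)"
    define c where "c = cos (pi * \<alpha> / 2)"
    have S: "S \<noteq> 0"
    proof (cases "\<alpha> > 0")
      case True
      then have "0 < S" unfolding S_def using assms(3) by (intro sin_gt_zero) auto
      then show ?thesis by simp
    next
      case neg: False
      have "pi * (-2) < pi * \<alpha>" "pi * \<alpha> < pi * 0"
        using neg False assms(2) by (intro mult_strict_left_mono; simp)+
      then have "0 < sin (pi * (- \<alpha>) / 2)" by (intro sin_gt_zero) auto
      then show ?thesis by (simp add: S_def)
    qed
    \<comment> \<open>For -2 < \<alpha> < 1 the cosine vanishes only at \<alpha> = -1, the excluded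
      value.\<close>
    have c: "c \<noteq> 0"
    proof (cases "\<alpha> > -1")
      case True
      have "pi * (-1) < pi * \<alpha>" "pi * \<alpha> < pi * 1"
        using True assms(3) by (intro mult_strict_left_mono; simp)+
      then have "0 < c" unfolding c_def by (intro cos_gt_zero_pi) auto
      then show ?thesis by simp
    next
      case neg: False
      have "pi * (-2) < pi * \<alpha>" "pi * \<alpha> < pi * (-1)"
        using neg assms(2,4) by (intro mult_strict_left_mono; simp)+
      then have "0 < cos (pi * \<alpha> / 2 + pi)" by (intro cos_gt_zero_pi) auto
      then show ?thesis by (simp add: c_def)
    qed
    have kS: "k = S / c" using assms(5) by (simp add: tan_def S_def c_def)
    obtain \<delta> L where lip: "0 < \<delta>" "\<And>s. \<bar>s - y\<bar> < \<delta> \<Longrightarrow>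
        \<bar>dirichlet_kernel \<alpha> x t s - dirichlet_kernel \<alpha> x t y\<bar> \<le> L * \<bar>s - y\<bar>"
      by (rule dirichlet_kernel_lipschitz[OF assms(1,6), where \<alpha> = \<alpha> and x = x], rule that)
    define R where "R = of_real \<tau> * (- of_real pi * A) + w * (of_real (pi / S) * (A powr (- of_real \<alpha>) - of_real (Y powr (- \<alpha>) * c)))"
    have "K_op (\<lambda>s. of_real (dirichlet_kernel \<alpha> x t s)) y = complex_of_real (Im (R / N)) / of_real pi"
    proof (rule K_op_eqI[OF _ assms(6) _ lip(1)])
      show "norm (complex_of_real (dirichlet_kernel \<alpha> x t s) - of_real (dirichlet_kernel \<alpha> x t y)) \<le> L * \<bar>s - y\<bar>"
        if "\<bar>s - y\<bar> < \<delta>" for s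
        using lip(2)[OF that] by (simp flip: of_real_diff)
      show "integrable lborel (\<lambda>s. complex_of_real (dirichlet_kernel \<alpha> x t s) / of_real (sqrt (1 + s\<^sup>2)))"
        by (rule integrable_dirichlet_kernel_div_sqrt) (use assms in auto)
      show "((\<lambda>\<epsilon>. LINT s|half_line. of_real (dirichlet_kernel \<alpha> x t (sgn y * s)) * of_real (reg_kernel \<epsilon> \<bar>y\<bar> s))
          \<longlongrightarrow> complex_of_real (Im (R / N))) (at_right 0)"
        unfolding R_def N_def A_def w_def z_def \<tau>_def S_def c_def Y_def[symmetric] \<sigma>_def[symmetric]
        by (rule tendsto_integral_dirichlet_kernel) (use assms(1-3) False Y(1,2) in auto)
    qed simp
    also have "\<dots> = of_real (Im (R / of_real pi / N))"
    proof -
      have "R / of_real pi / N = R / N / of_real pi" by simp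
      then show ?thesis by (simp only: Im_divide_of_real of_real_divide)
    qed
    finally have "I_plus_kK k (\<lambda>s. of_real (dirichlet_kernel \<alpha> x t s)) y =
        of_real (dirichlet_kernel \<alpha> x t y + k * Im (R / of_real pi / N))"
      unfolding I_plus_kK_def by simp
    also have "dirichlet_kernel \<alpha> x t y + k * Im (R / of_real pi / N) =
       Im ((of_real \<tau> * of_real Y + w * of_real (Y powr (- \<alpha>)) + of_real k * (R / of_real pi)) / N)"
    proof -
      have "Im (of_real k * V / N) = k * Im (V / N)" for V
        by (simp only: times_divide_eq_right[symmetric] times_complex.simps Re_complex_of_real
          Im_complex_of_real mult_zero_left add_0_right)
      then show ?thesis
        unfolding kernel by (simp only: add_divide_distrib plus_complex.simps)
    qed
    also have "of_real k * (R / of_real pi) =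
        of_real \<tau> * (- of_real k * A) + (w * A powr (- of_real \<alpha>)) / of_real c - w * of_real (Y powr (- \<alpha>))"
    proof -
      have "of_real k * (R / of_real pi) =
        of_real \<tau> * (- of_real k * A) + (of_real k / of_real S) * (w * A powr (- of_real \<alpha>)) - (of_real k / of_real S * of_real c) * (w * of_real (Y powr (- \<alpha>)))"
      proof -
        have "k' * ((T * (- P * A) + w * (P / S' * (a - b * c'))) / P) =
            T * (- k' * A) + (k' / S') * (w * a) - (k' / S' * c') * (w * b)"
          if "P \<noteq> 0" for k' T P S' a b c' :: complex
        proof -
          have "(T * (- P * A) + w * (P / S' * (a - b * c'))) / P = T * (- A) + w * (a - b * c') / S'"
          proof -
            have "T * (- P * A) + w * (P / S' * d) = P * (T * (- A) + w * d / S')" for d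
              by (simp add: right_diff_distrib distrib_left mult_ac)
            then show ?thesis using that by simp
          qed
          then show ?thesis by (rule ssubst) (simp add: algebra_simps diff_divide_distrib)
        qed
        then show ?thesis unfolding R_def by simp
      qed
      \<comment> \<open>This coefficient 1 makes the Y^(-\<alpha>) term of kK cancel that of the
        kernel itself: the reason for tan(pi \<alpha> / 2) = k.\<close>
      also have "of_real k / of_real S * (of_real c :: complex) = 1" using S c by (simp add: kS)
      also have "of_real k / (of_real S :: complex) = 1 / of_real c" using S c by (simp add: kS)
      finally show ?thesis by simp
    qed
    \<comment> \<open>The phase produced by z^(\<alpha>+1) A^(-\<alpha>), divided by the cosine, is
      the coefficient 1 + ik in the numerator of the layer kernel.\<close>
    also have "w * A powr (- of_real \<alpha>) / of_real c = (1 + \<i> * of_real k) * z"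
    proof -
      have "exp (\<i> * of_real (pi * \<alpha> / 2)) / of_real c = 1 + \<i> * of_real k"
        using c assms(5) unfolding c_def by (rule exp_half_angle_div_cos)
      then show ?thesis
        unfolding w_def z_def A_def powr_Suc_times_rotated_powr[OF assms(1)]
        by (simp only: times_divide_eq_left[symmetric])
    qed
    also have "of_real \<tau> * of_real Y + w * of_real (Y powr (- \<alpha>)) +
        (of_real \<tau> * (- of_real k * A) + (1 + \<i> * of_real k) * z - w * of_real (Y powr (- \<alpha>))) =
        of_real \<tau> * (of_real Y - of_real k * A) + (1 + \<i> * of_real k) * z"
      by (simp add: algebra_simps)
    finally show ?thesis unfolding layer .
  qed
qed

theorem mainTheorem2:
  fixes p q k \<alpha> :: real
    and u :: "real \<Rightarrow> complex"
    and U :: "real \<Rightarrow> real \<Rightarrow> complex"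
  assumes "1 < p"
    and "1 / q = 1 - 1 / p"
    and "k \<noteq> tan (pi / (2 * q))"
    and "1 / q - 2 < \<alpha>" and "\<alpha> < 1 / q" and "\<alpha> \<noteq> -1"
    and "tan (pi * \<alpha> / 2) = k"
    and "u \<in> Lp p"
    and "boundary_equation_solution p q k u U"
  shows "\<forall>t x. t > 0 \<longrightarrow>
    U t x = 1 / of_real pi *
      (LINT y|lborel.
         of_real ((2 * x * t * y
                   + \<bar>y\<bar> powr (- \<alpha>) *
                     Im ((of_real \<bar>x\<bar> + \<i> * of_real t) powr of_real (\<alpha> + 1) *
                         ((of_real y)\<^sup>2 - (of_real \<bar>x\<bar> - \<i> * of_real t)\<^sup>2)))
                  / ((t\<^sup>2 + (x - y)\<^sup>2) * (t\<^sup>2 + (x + y)\<^sup>2))) * u y)"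
proof (intro allI impI)
  fix t x :: real assume t: "t > 0"
  have q: "0 < 1 / q" "1 / q < 1"
    unfolding assms(2) using assms(1) by (auto simp: field_simps)
  then have \<alpha>: "-2 < \<alpha>" "\<alpha> < 1" using assms(4,5) by linarith+
  from q have q1: "1 < q" by (simp add: field_simps split: if_splits)
  obtain \<psi> v where \<psi>: "is_adjoint_value p q (I_plus_kK k) \<psi> v" "AE x in lborel. u x = 1 / 2 * v x"
    "\<And>t x. t > 0 \<Longrightarrow> U t x = layer_potential k \<psi> t x"
    using assms(9) unfolding boundary_equation_solution_def by blast
  define f where "f = (\<lambda>y. complex_of_real (dirichlet_kernel \<alpha> x t y))"
  have "f \<in> Lp q"
    unfolding f_def by (rule dirichlet_kernel_in_Lp) (use t q1 assms in auto)
  then have adj: "(LINT y|lborel. I_plus_kK k f y * \<psi> y) = (LINT y|lborel. f y * v y)"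
    using \<psi>(1) unfolding is_adjoint_value_def by blast
  have [measurable]: "f \<in> borel_measurable borel" "u \<in> borel_measurable borel" "v \<in> borel_measurable borel"
    using assms(8) \<psi>(1) unfolding f_def is_adjoint_value_def Lp_def by auto
  have "U t x = 1 / (2 * of_real pi) * (LINT y|lborel. of_real (layer_kernel k x t y) * \<psi> y)"
    unfolding \<psi>(3)[OF t] layer_potential_def layer_kernel_def ..
  also have "(LINT y|lborel. of_real (layer_kernel k x t y) * \<psi> y) = (LINT y|lborel. I_plus_kK k f y * \<psi> y)"
  \<comment> \<open>The boundary equation is known only for y different from 0; the single point 0
    has measure 0.\<close>
  proof (rule integral_discrete_difference[where X = "{0}"])
    show "of_real (layer_kernel k x t y) * \<psi> y = I_plus_kK k f y * \<psi> y" if "y \<notin> {0}" for y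
      unfolding f_def using that t \<alpha> assms(6,7) by (subst I_plus_kK_dirichlet_kernel) auto
  qed auto
  \<comment> \<open>The datum enters here: the adjoint value v equals 2u almost everywhere, and this
    2 cancels the one in the prefactor 1 / (2 pi).\<close>
  also have "\<dots> = (LINT y|lborel. 2 * (f y * u y))"
    unfolding adj
  proof (rule integral_cong_AE)
    show "AE y in lborel. f y * v y = 2 * (f y * u y)"
      using \<psi>(2)
    proof eventually_elim
      case (elim y)
      show ?case unfolding elim by simp
    qed
  qed simp_all
  also have "\<dots> = 2 * (LINT y|lborel. f y * u y)"
    by (rule integral_mult_right_zero)
  finally have "U t x = 1 / of_real pi * (LINT y|lborel. f y * u y)"
    by simp
  then show "U t x = 1 / of_real pi *
      (LINT y|lborel.
         of_real ((2 * x * t * y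
                   + \<bar>y\<bar> powr (- \<alpha>) *
                     Im ((of_real \<bar>x\<bar> + \<i> * of_real t) powr of_real (\<alpha> + 1) *
                         ((of_real y)\<^sup>2 - (of_real \<bar>x\<bar> - \<i> * of_real t)\<^sup>2)))
                  / ((t\<^sup>2 + (x - y)\<^sup>2) * (t\<^sup>2 + (x + y)\<^sup>2))) * u y)"
    unfolding f_def dirichlet_kernel_def .
qed

end
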